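(* If $\beta=(\beta_1,\beta_2,\ldots,\beta_d)\vdash n$ where $\beta_i\geq 3$ for all $i$, or $\beta=[1,n-1]$, then both of the sequences $$\xi_{n,1}([2,n-2],\beta),\ \xi_{n,3}([2,n-2],\beta),\ \xi_{n,5}([2,n-2],\beta),\ldots$$ and $$\xi_{n,2}([2,n-2],\beta),\ \xi_{n,4}([2,n-2],\beta),\ \xi_{n,6}([2,n-2],\beta),\ldots$$ are log-concave and unimodal.
   Context: $[p,n-p]$ denotes the partition of $n$ with parts $p$ and $n-p$ (here $n\ge 3$, so that $[2,n-2]$ is a partition with two parts). For partitions $\alpha,\beta$ of $n$, $\xi_{n,m}(\alpha,\beta)$ is the number of pairs $(\sigma_1,\sigma_2)$ of permutations of $\{1,\ldots,n\}$, with $\sigma_1$ of cycle-type $\alpha$ and $\sigma_2$ of cycle-type $\beta$, such that the product $\sigma_1\sigma_2$ has exactly $m$ disjoint cycles (fixed points counted). A sequence $(a_i)$ of nonnegative numbers is log-concave if $a_i^2\ge a_{i-1}a_{i+1}$ for all interior $i$, and unimodal if it is weakly increasing up to some index and weakly decreasing afterwards. An identically zero sequence counts as log-concave and unimodal. *)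

theory Defs
  imports "HOL-Library.Multiset" "HOL-Combinatorics.Orbits"
begin

definition is_partition :: "nat multiset \<Rightarrow> nat \<Rightarrow> bool" where
  "is_partition \<alpha> n \<longleftrightarrow> (\<forall>a\<in>#\<alpha>. 0 < a) \<and> sum_mset \<alpha> = n"

text \<open>Since orbits are taken at every point of \<open>A\<close>, fixed points contribute singleton cycles.\<close>

definition cycles_on :: "'a set \<Rightarrow> ('a \<Rightarrow> 'a) \<Rightarrow> 'a set set" where
  "cycles_on A p = orbit p ` A"

definition cycle_type_on :: "'a set \<Rightarrow> ('a \<Rightarrow> 'a) \<Rightarrow> nat multiset" where
  "cycle_type_on A p = image_mset card (mset_set (cycles_on A p))"

definition xi :: "nat \<Rightarrow> nat \<Rightarrow> nat multiset \<Rightarrow> nat multiset \<Rightarrow> nat" where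
  "xi n m \<alpha> \<beta> = card {(\<sigma>\<^sub>1, \<sigma>\<^sub>2). \<sigma>\<^sub>1 permutes {1..n} \<and> \<sigma>\<^sub>2 permutes {1..n} \<and>
     cycle_type_on {1..n} \<sigma>\<^sub>1 = \<alpha> \<and> cycle_type_on {1..n} \<sigma>\<^sub>2 = \<beta> \<and>
     card (cycles_on {1..n} (\<sigma>\<^sub>1 \<circ> \<sigma>\<^sub>2)) = m}"

definition log_concave :: "(nat \<Rightarrow> nat) \<Rightarrow> bool" where
  "log_concave a \<longleftrightarrow> (\<forall>i\<ge>1. a (i - 1) * a (i + 1) \<le> (a i)\<^sup>2)"

definition unimodal :: "(nat \<Rightarrow> nat) \<Rightarrow> bool" where
  "unimodal a \<longleftrightarrow> (\<exists>k. mono_on {..k} a \<and> antimono_on {k..} a)"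

end

theory Submission
  imports Defs "HOL-Computational_Algebra.Fundamental_Theorem_Algebra"
begin

text \<open>
  For a permutation \<open>\<tau>\<close> of an \<open>N\<close>-set with cycle lengths \<open>\<gamma>\<close>, the sum of \<open>q\<close> to the number of
  cycles of \<open>c \<circ> \<tau>\<close> over all \<open>N\<close>-cycles \<open>c\<close> is a multiple of \<open>\<Prod>(1 - E ^ \<gamma>\<^sub>i)\<close> applied to the
  polynomial \<open>q (q + 1) \<cdots> (q + N) / (N + 1)!\<close>, where \<open>E f(q) = f(q - 1)\<close>. This follows by induction
  on \<open>N\<close>: removing a point \<open>x\<close> from \<open>c\<close> amounts to multiplying \<open>\<tau>\<close> by a transposition \<open>(x y)\<close> and
  deleting \<open>x\<close> from its cycle, which splits or joins cycles of \<open>\<tau>\<close>. Writing a permutation of type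
  \<open>[2, n - 2]\<close> as a transposition times an \<open>(n - 2)\<close>-cycle, and one of type \<open>[1, n - 1]\<close> as an
  \<open>(n - 1)\<close>-cycle, reduces both generating functions \<open>\<Sum>m. \<xi>(m) q ^ m\<close> to this formula.

  If all roots of \<open>a\<close> lie on the unit circle, then \<open>a(E)\<close> sends products of consecutive linear factors to
  polynomials whose remaining roots lie on a vertical line. When all parts of \<open>\<beta>\<close> are at least 3, the
  generating function is a multiple of \<open>q ((q + 1) U(q + 2) + (q - 1) U(q + 1))\<close> where the roots of
  \<open>U\<close> have real part 3/2, and comparing absolute values shows that all its roots are purely imaginary.
  The same holds for \<open>[1, n - 1]\<close>. A real polynomial with purely imaginary roots is a product of factors
  \<open>q\<close> and \<open>q\<^sup>2 + b\<close> with \<open>b > 0\<close>, so the coefficients of each parity form a log-concave sequence without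
  internal zeros.
\<close>

section \<open>Polynomials in the shift operator\<close>

text \<open>This is the operator \<open>a(E)\<close> applied to \<open>f\<close>, where
  \<open>E\<close> is the backward shift \<open>f(q) -> f(q - 1)\<close>. Multiplying polynomials
  composes operators, so recursions for functions of \<open>q\<close> become identities between
  polynomials.\<close>

definition shift_op :: "complex poly \<Rightarrow> (complex \<Rightarrow> complex) \<Rightarrow> complex \<Rightarrow> complex" where
  "shift_op a f q = (\<Sum>k\<le>degree a. coeff a k * f (q - of_nat k))"

lemma shift_op_bound:
  assumes "degree a \<le> N"
  shows "shift_op a f q = (\<Sum>k\<le>N. coeff a k * f (q - of_nat k))"
  unfolding shift_op_def using assms
  by (intro sum.mono_neutral_left) (auto simp: coeff_eq_0)

lemma shift_op_0 [simp]: "shift_op 0 f q = 0"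
  by (simp add: shift_op_def)

lemma shift_op_add: "shift_op (a + b) f q = shift_op a f q + shift_op b f q"
proof -
  define N where "N = max (degree a) (degree b)"
  have "degree (a + b) \<le> N" "degree a \<le> N" "degree b \<le> N"
    by (auto simp: N_def intro: degree_add_le)
  thus ?thesis
    by (simp add: shift_op_bound[of _ N] sum.distrib algebra_simps)
qed

lemma shift_op_smult: "shift_op (smult c a) f q = c * shift_op a f q"
proof -
  have "degree (smult c a) \<le> degree a" by simp
  thus ?thesis
    by (simp add: shift_op_bound[of _ "degree a"] sum_distrib_left mult.assoc)
qed

lemma shift_op_minus: "shift_op (- a) f q = - shift_op a f q"
  using shift_op_smult[of "-1" a f q] by simp

lemma shift_op_diff: "shift_op (a - b) f q = shift_op a f q - shift_op b f q"
  using shift_op_add[of a "- b" f q] by (simp add: shift_op_minus)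

lemma shift_op_sum: "shift_op (\<Sum>i\<in>I. a i) f q = (\<Sum>i\<in>I. shift_op (a i) f q)"
  by (induction I rule: infinite_finite_induct) (auto simp: shift_op_add)

lemma shift_op_fun_diff: "shift_op a (\<lambda>q. f q - g q) q = shift_op a f q - shift_op a g q"
  by (simp add: shift_op_def right_diff_distrib sum_subtractf)

lemma shift_op_pCons: "shift_op (pCons c a) f q = c * f q + shift_op a f (q - 1)"
proof -
  have "degree (pCons c a) \<le> Suc (degree a)" by (rule degree_pCons_le)
  hence "shift_op (pCons c a) f q = (\<Sum>k\<le>Suc (degree a). coeff (pCons c a) k * f (q - of_nat k))"
    by (rule shift_op_bound)
  also have "\<dots> = c * f q + (\<Sum>k\<le>degree a. coeff a k * f (q - of_nat (Suc k)))"
    by (subst sum.atMost_Suc_shift) simp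
  finally show ?thesis by (simp add: shift_op_def algebra_simps)
qed

lemma shift_op_X_mult: "shift_op ([:0, 1:] * a) f q = shift_op a f (q - 1)"
  by (simp add: shift_op_pCons)

section \<open>Shift operators acting on rising factorials\<close>

definition rising_binom :: "nat \<Rightarrow> complex \<Rightarrow> complex" where
  "rising_binom m q = pochhammer q m / fact m"

text \<open>Pascal's rule: \<open>1 - E\<close> lowers the index by one. A factor
  \<open>1 - X\<close> can therefore be traded for a change of index.\<close>

lemma rising_binom_diff:
  "rising_binom (Suc m) q - rising_binom (Suc m) (q - 1) = rising_binom m q"
proof -
  have "pochhammer q (Suc m) - pochhammer (q - 1) (Suc m) = of_nat (Suc m) * pochhammer q m"
    using pochhammer_rec[of "q - 1" m] by (simp add: pochhammer_Suc algebra_simps)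
  moreover have "of_nat (Suc m) \<noteq> (0 :: complex)"
    by (rule of_nat_neq_0)
  ultimately show ?thesis
    by (simp add: rising_binom_def diff_divide_distrib [symmetric] del: of_nat_Suc pochhammer_Suc)
qed

text \<open>Multiplication by \<open>q\<close> is the operator \<open>1 + m E\<close> once the index
  is raised, so it too can be encoded in the polynomial.\<close>

lemma rising_binom_times_arg:
  "q * rising_binom m q = rising_binom (Suc m) q + of_nat m * rising_binom (Suc m) (q - 1)"
proof -
  have "pochhammer (q - 1) (Suc m) = (q - 1) * pochhammer q m"
    using pochhammer_rec[of "q - 1" m] by simp
  hence "pochhammer q (Suc m) + of_nat m * pochhammer (q - 1) (Suc m) = of_nat (Suc m) * (q * pochhammer q m)"
    by (simp only: pochhammer_Suc) (simp add: algebra_simps)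
  hence "(pochhammer q (Suc m) + of_nat m * pochhammer (q - 1) (Suc m)) / fact (Suc m) = q * pochhammer q m / fact m"
    using of_nat_neq_0[of m, where 'a=complex]
    by (simp add: del: of_nat_Suc pochhammer_Suc)
  thus ?thesis by (simp add: rising_binom_def add_divide_distrib del: pochhammer_Suc fact_Suc)
qed

lemma shift_op_one_minus:
  "shift_op ([:1, -1:] * a) (rising_binom (Suc m)) q = shift_op a (rising_binom m) q"
proof -
  have "[:1, -1:] * a = a - [:0, 1:] * a" by (simp)
  hence "shift_op ([:1, -1:] * a) (rising_binom (Suc m)) q =
      shift_op a (rising_binom (Suc m)) q - shift_op a (rising_binom (Suc m)) (q - 1)"
    by (simp only: shift_op_diff shift_op_X_mult)
  also have "shift_op a (rising_binom (Suc m)) (q - 1) = shift_op a (\<lambda>q. rising_binom (Suc m) (q - 1)) q"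
    by (simp add: shift_op_def algebra_simps)
  also have "shift_op a (rising_binom (Suc m)) q - \<dots> = shift_op a (rising_binom m) q"
    by (simp only: shift_op_fun_diff [symmetric] rising_binom_diff)
  finally show ?thesis .
qed

text \<open>Since \<open>q E^k = E^k q + k E^k\<close>, moving \<open>q\<close> past
  \<open>a(E)\<close> produces the extra operator \<open>(X a')(E)\<close>. It acts on index
  \<open>m\<close>, which is \<open>1 - E\<close> applied to index \<open>m + 1\<close>; the
  remaining \<open>q\<close> is absorbed by \<open>rising_binom_times_arg\<close>.\<close>

lemma shift_op_times_arg:
  "q * shift_op a (rising_binom m) q =
   shift_op ([:1, -1:] * [:0, 1:] * pderiv a + [:1, of_nat m:] * a) (rising_binom (Suc m)) q"
proof (induction a arbitrary: q rule: pCons_induct)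
  case 0
  show ?case by simp
next
  case (pCons c a)
  let ?R = "rising_binom (Suc m)"
  let ?b = "[:1, -1:] * [:0, 1:] * pderiv a + [:1, of_nat m:] * a"
  have eq: "[:1, -1:] * [:0, 1:] * pderiv (pCons c a) + [:1, of_nat m:] * pCons c a =
      smult c [:1, of_nat m:] + [:0, 1:] * ?b + [:0, 1:] * ([:1, -1:] * a)"
  proof -
    have "pCons c a = [:c:] + [:0, 1:] * a" by simp
    moreover have "pderiv (pCons c a) = a + [:0, 1:] * pderiv a"
      by (simp add: pderiv_pCons)
    moreover have "smult c [:1, of_nat m:] = [:c:] * [:1, of_nat m:]" by simp
    ultimately show ?thesis by (simp only:) (simp only: algebra_simps)
  qed
  have "shift_op ([:1, -1:] * [:0, 1:] * pderiv (pCons c a) + [:1, of_nat m:] * pCons c a) ?R q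
      = c * (?R q + of_nat m * ?R (q - 1)) + (q - 1) * shift_op a (rising_binom m) (q - 1)
          + shift_op a (rising_binom m) (q - 1)"
    unfolding eq shift_op_add shift_op_smult shift_op_X_mult shift_op_one_minus pCons.IH
    by (simp add: shift_op_pCons algebra_simps)
  also have "\<dots> = q * shift_op (pCons c a) (rising_binom m) q"
    unfolding rising_binom_times_arg [symmetric] by (simp add: shift_op_pCons algebra_simps)
  finally show ?case by simp
qed

abbreviation X :: "complex poly" where "X \<equiv> [:0, 1:]"

definition euler_deriv :: "complex poly \<Rightarrow> complex poly" where
  "euler_deriv a = X * pderiv a"

lemma euler_deriv_1 [simp]: "euler_deriv 1 = 0"
  by (simp add: euler_deriv_def)

lemma euler_deriv_diff: "euler_deriv (a - b) = euler_deriv a - euler_deriv b"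
  by (simp only: euler_deriv_def pderiv_diff right_diff_distrib)

lemma euler_deriv_mult: "euler_deriv (a * b) = euler_deriv a * b + a * euler_deriv b"
  by (simp only: euler_deriv_def pderiv_mult) (simp only: algebra_simps mult_1_left mult_1_right mult_zero_left mult_zero_right diff_0 add_0 add_0_right minus_diff_eq mult_minus_left mult_minus_right add.right_inverse)

lemma euler_deriv_X_power: "euler_deriv (X ^ n) = of_nat n * X ^ n"
proof (cases n)
  case (Suc m)
  have "euler_deriv (X ^ n) = X * (of_nat n * X ^ m)"
    by (simp only: euler_deriv_def Suc pderiv_power_Suc) (simp add: pderiv_pCons of_nat_poly)
  thus ?thesis by (simp only: Suc power_Suc) (simp only: ac_simps)
qed (simp only: power_0 euler_deriv_1 of_nat_0 mult_zero_left)

lemma shift_op_one_minus_X: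
  "shift_op ((1 - X) * a) (rising_binom (Suc m)) q = shift_op a (rising_binom m) q"
proof -
  have "1 - X = [:1, -1:]" by (simp add: one_pCons)
  thus ?thesis by (simp only: shift_op_one_minus)
qed

lemma shift_op_times_arg_X:
  "q * shift_op a (rising_binom m) q =
   shift_op ((1 - X) * euler_deriv a + (1 + of_nat m * X) * a) (rising_binom (Suc m)) q"
proof -
  have "1 - X = [:1, -1:]" "1 + of_nat m * X = [:1, of_nat m:]"
    by (simp_all add: one_pCons of_nat_poly)
  thus ?thesis by (simp only: shift_op_times_arg euler_deriv_def mult.assoc)
qed

lemma shift_op_of_nat_mult: "shift_op (of_nat k * a) f q = of_nat k * shift_op a f q"
  by (simp add: of_nat_poly shift_op_smult)

lemma shift_op_sum_mset: "shift_op (\<Sum>i\<in>#M. a i) f q = (\<Sum>i\<in>#M. shift_op (a i) f q)"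
  by (induction M) (auto simp: shift_op_add)

section \<open>Polynomial identities for splitting, joining and shortening cycles\<close>

definition cyc_poly :: "nat multiset \<Rightarrow> complex poly" where
  "cyc_poly \<gamma> = (\<Prod>l\<in>#\<gamma>. 1 - X ^ l)"

lemma cyc_poly_empty [simp]: "cyc_poly {#} = 1"
  by (simp add: cyc_poly_def)

lemma cyc_poly_add_mset: "cyc_poly (add_mset l \<gamma>) = (1 - X ^ l) * cyc_poly \<gamma>"
  by (simp add: cyc_poly_def)

text \<open>The Leibniz rule for the operator \<open>X d/dX\<close>, which sends
  \<open>1 - X ^ m\<close> to \<open>- m X ^ m\<close>.\<close>

lemma sum_mset_cyc_poly_euler:
  "(\<Sum>m\<in>#\<delta>. of_nat m * X ^ m * cyc_poly (\<delta> - {#m#})) = - euler_deriv (cyc_poly \<delta>)"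
proof (induction \<delta>)
  case empty
  show ?case by simp
next
  case (add k \<delta>)
  have "(\<Sum>m\<in>#\<delta>. of_nat m * X ^ m * cyc_poly (add_mset k \<delta> - {#m#}))
      = (\<Sum>m\<in>#\<delta>. (1 - X ^ k) * (of_nat m * X ^ m * cyc_poly (\<delta> - {#m#})))"
  proof (intro arg_cong[of _ _ sum_mset] image_mset_cong)
    fix m assume "m \<in># \<delta>"
    hence "add_mset k \<delta> - {#m#} = add_mset k (\<delta> - {#m#})" by simp
    thus "of_nat m * X ^ m * cyc_poly (add_mset k \<delta> - {#m#})
        = (1 - X ^ k) * (of_nat m * X ^ m * cyc_poly (\<delta> - {#m#}))"
      by (simp only: cyc_poly_add_mset ac_simps)
  qed
  also have "\<dots> = - (1 - X ^ k) * euler_deriv (cyc_poly \<delta>)"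
    by (simp only: sum_mset_distrib_left [symmetric] add.IH) (simp only: mult_minus_left mult_minus_right)
  finally show ?case
    by (simp only: image_mset_add_mset sum_mset.add_mset add_mset_remove_trivial cyc_poly_add_mset
        euler_deriv_mult euler_deriv_diff euler_deriv_1 euler_deriv_X_power)
       (simp only: algebra_simps mult_1_left mult_1_right mult_zero_left mult_zero_right diff_0 add_0 add_0_right minus_diff_eq mult_minus_left mult_minus_right add.right_inverse)
qed

text \<open>The sum is over all joins of a cycle of remaining length \<open>c\<close> with a cycle
  of length \<open>m\<close>, each possible in \<open>m\<close> ways. Write
  \<open>1 - X ^ (c + m)\<close> as \<open>(1 - X ^ m) + X ^ m (1 - X ^ c)\<close>: the first part
  restores \<open>cyc_poly\<close>, the second gives the Leibniz sum.\<close>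

lemma sum_mset_cyc_poly_join:
  "(\<Sum>m\<in>#\<delta>. of_nat m * ((1 - X ^ (c + m)) * cyc_poly (\<delta> - {#m#})))
   = of_nat (sum_mset \<delta>) * cyc_poly \<delta> - (1 - X ^ c) * euler_deriv (cyc_poly \<delta>)"
proof -
  have "(\<Sum>m\<in>#\<delta>. of_nat m * ((1 - X ^ (c + m)) * cyc_poly (\<delta> - {#m#})))
      = (\<Sum>m\<in>#\<delta>. of_nat m * cyc_poly \<delta> + (1 - X ^ c) * (of_nat m * X ^ m * cyc_poly (\<delta> - {#m#})))"
  proof (intro arg_cong[of _ _ sum_mset] image_mset_cong)
    fix m assume "m \<in># \<delta>"
    hence "cyc_poly \<delta> = (1 - X ^ m) * cyc_poly (\<delta> - {#m#})"
      using cyc_poly_add_mset[of m "\<delta> - {#m#}"] by simp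
    thus "of_nat m * ((1 - X ^ (c + m)) * cyc_poly (\<delta> - {#m#}))
        = of_nat m * cyc_poly \<delta> + (1 - X ^ c) * (of_nat m * X ^ m * cyc_poly (\<delta> - {#m#}))"
      by (simp only: power_add) (simp only: algebra_simps mult_1_left mult_1_right mult_zero_left mult_zero_right diff_0 add_0 add_0_right minus_diff_eq mult_minus_left mult_minus_right add.right_inverse)
  qed
  also have "\<dots> = (\<Sum>m\<in>#\<delta>. of_nat m * cyc_poly \<delta>)
      + (1 - X ^ c) * (\<Sum>m\<in>#\<delta>. of_nat m * X ^ m * cyc_poly (\<delta> - {#m#}))"
    by (simp only: sum_mset.distrib sum_mset_distrib_left)
  also have "(\<Sum>m\<in>#\<delta>. of_nat m * cyc_poly \<delta>) = of_nat (sum_mset \<delta>) * cyc_poly \<delta>"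
    by (simp only: sum_mset_distrib_right [symmetric] of_nat_sum_mset)
  finally show ?thesis
    unfolding sum_mset_cyc_poly_euler by (simp only: mult_minus_right diff_conv_add_uminus)
qed

text \<open>Expanding the summand leaves a constant and two geometric series, which
  \<open>1 - x\<close> makes telescope. The parts \<open>i\<close> and \<open>m - i\<close> are what
  a split leaves after one point is deleted.\<close>

lemma split_sum_one:
  fixes x :: "'a :: comm_ring_1"
  shows "(1 - x) * (\<Sum>i<m. (1 - x ^ i) * (1 - x ^ (m - i))) =
    of_nat m * (1 - x) * (1 + x ^ m) - (1 + x) * (1 - x ^ m)"
proof -
  have "(\<Sum>i<m. (1 - x ^ i) * (1 - x ^ (m - i))) = (\<Sum>i<m. (1 + x ^ m) - x ^ i - x ^ (m - i))"
    by (intro sum.cong refl) (simp add: algebra_simps flip: power_add)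
  also have "\<dots> = of_nat m * (1 + x ^ m) - (\<Sum>i<m. x ^ i) - (\<Sum>i<m. x ^ (m - i))"
    by (simp add: sum_subtractf)
  also have "(\<Sum>i<m. x ^ (m - i)) = (\<Sum>i<m. x ^ Suc i)"
    by (rule sum.nat_diff_reindex[of "\<lambda>i. x ^ Suc i" m, symmetric, THEN trans, symmetric])
       (auto intro!: sum.cong simp: Suc_diff_Suc simp flip: power_Suc)
  also have "\<dots> = x * (\<Sum>i<m. x ^ i)" by (simp add: sum_distrib_left)
  finally have eq: "(\<Sum>i<m. (1 - x ^ i) * (1 - x ^ (m - i))) =
      of_nat m * (1 + x ^ m) - (\<Sum>i<m. x ^ i) - x * (\<Sum>i<m. x ^ i)" .
  have d: "1 - x ^ m = (1 - x) * (\<Sum>i<m. x ^ i)" by (rule one_diff_power_eq)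
  show ?thesis unfolding eq d by (simp add: algebra_simps)
qed

text \<open>The same computation when two points are deleted, so that the parts add up to
  \<open>m - 1\<close>.\<close>

lemma split_sum_two:
  fixes x :: "'a :: comm_ring_1"
  shows "(1 - x) * (\<Sum>i<m. (1 - x ^ i) * (1 - x ^ (m - Suc i))) =
    of_nat m * (1 - x) * (1 + x ^ (m - 1)) - 2 * (1 - x ^ m)"
proof -
  have "(\<Sum>i<m. (1 - x ^ i) * (1 - x ^ (m - Suc i))) = (\<Sum>i<m. (1 + x ^ (m - 1)) - x ^ i - x ^ (m - Suc i))"
    by (intro sum.cong refl) (simp add: algebra_simps flip: power_add)
  also have "\<dots> = of_nat m * (1 + x ^ (m - 1)) - (\<Sum>i<m. x ^ i) - (\<Sum>i<m. x ^ (m - Suc i))"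
    by (simp add: sum_subtractf)
  also have "(\<Sum>i<m. x ^ (m - Suc i)) = (\<Sum>i<m. x ^ i)"
    by (rule sum.nat_diff_reindex)
  finally have eq: "(\<Sum>i<m. (1 - x ^ i) * (1 - x ^ (m - Suc i))) =
      of_nat m * (1 + x ^ (m - 1)) - (\<Sum>i<m. x ^ i) - (\<Sum>i<m. x ^ i)" .
  have d: "1 - x ^ m = (1 - x) * (\<Sum>i<m. x ^ i)" by (rule one_diff_power_eq)
  show ?thesis unfolding eq d by (simp add: algebra_simps)
qed

text \<open>With the parts equal to 0 contributing the factor \<open>1 - X ^ 0 = 0\<close>, the boundary terms of
  the two recursions need no separate treatment.\<close>

lemma long_cycle_recursion_poly:
  fixes m :: nat and \<delta> :: "nat multiset"
  defines "g \<equiv> cyc_poly \<delta>" and "N \<equiv> m + sum_mset \<delta>"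
  shows "of_nat N * shift_op ((1 - X ^ Suc m) * g) (rising_binom (Suc (Suc N))) q =
    q * shift_op ((1 - X ^ m) * g) (rising_binom (Suc N)) q
    + (\<Sum>i<m. shift_op ((1 - X ^ i) * ((1 - X ^ (m - i)) * g)) (rising_binom (Suc N)) q)
    + (\<Sum>k\<in>#\<delta>. of_nat k * shift_op ((1 - X ^ (m + k)) * cyc_poly (\<delta> - {#k#})) (rising_binom (Suc N)) q)"
proof -
  define S where "S = (\<Sum>i<m. (1 - X ^ i) * (1 - X ^ (m - i)))"
  define J where "J = (\<Sum>k\<in>#\<delta>. of_nat k * ((1 - X ^ (m + k)) * cyc_poly (\<delta> - {#k#})))"
  define Y where "Y = X ^ m"
  have S: "(1 - X) * S = of_nat m * (1 - X) * (1 + Y) - (1 + X) * (1 - Y)"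
    unfolding S_def Y_def by (rule split_sum_one)
  have J: "J = of_nat (sum_mset \<delta>) * g - (1 - Y) * euler_deriv g"
    unfolding J_def g_def Y_def by (rule sum_mset_cyc_poly_join)
  have E: "euler_deriv ((1 - Y) * g) = (1 - Y) * euler_deriv g - of_nat m * Y * g"
    by (simp only: Y_def euler_deriv_mult euler_deriv_diff euler_deriv_1 euler_deriv_X_power)
       (simp only: algebra_simps mult_1_left mult_1_right mult_zero_left mult_zero_right diff_0 add_0 add_0_right minus_diff_eq mult_minus_left mult_minus_right add.right_inverse)
  \<comment> \<open>With \<open>X ^ m\<close> named \<open>Y\<close>, this is an identity in
    \<open>X\<close>, \<open>Y\<close>, \<open>g\<close> and its Euler derivative. The first bracket
    encodes multiplication by \<open>q\<close>; the factors \<open>1 - X\<close> on the other terms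
    lower the index of the rising factorial to that of the splits and joins.\<close>
  have "of_nat N * ((1 - X * Y) * g) =
      ((1 - X) * euler_deriv ((1 - Y) * g) + (1 + of_nat (Suc N) * X) * ((1 - Y) * g))
      + ((1 - X) * S) * g + (1 - X) * J"
    unfolding S J E N_def of_nat_Suc of_nat_add by algebra
  hence "of_nat N * ((1 - X ^ Suc m) * g) =
      ((1 - X) * euler_deriv ((1 - X ^ m) * g) + (1 + of_nat (Suc N) * X) * ((1 - X ^ m) * g))
      + (1 - X) * (S * g) + (1 - X) * J"
    by (simp only: Y_def power_Suc mult.assoc)
  hence "of_nat N * shift_op ((1 - X ^ Suc m) * g) (rising_binom (Suc (Suc N))) q =
      q * shift_op ((1 - X ^ m) * g) (rising_binom (Suc N)) q
      + shift_op (S * g) (rising_binom (Suc N)) q + shift_op J (rising_binom (Suc N)) q"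
    by (simp only: shift_op_times_arg_X shift_op_of_nat_mult [symmetric] shift_op_add shift_op_one_minus_X)
  thus ?thesis
    by (simp only: S_def J_def sum_distrib_right shift_op_sum shift_op_sum_mset shift_op_of_nat_mult mult.assoc)
qed

text \<open>The left side lists what happens when \<open>x\<close> and \<open>y\<close> are both
  deleted from \<open>(x y)\<close> times a permutation in which \<open>x\<close> has a cycle of
  length \<open>m + 2\<close>. The two terms with \<open>q\<close> come from the splits that isolate
  \<open>x\<close> or \<open>y\<close>; the sums run over the remaining splits and the
  joins.\<close>

lemma two_cycle_recursion_poly:
  fixes m :: nat and \<delta> :: "nat multiset"
  defines "g \<equiv> cyc_poly \<delta>" and "N \<equiv> m + sum_mset \<delta>"
  shows "2 * (q * shift_op ((1 - X ^ m) * g) (rising_binom (Suc N)) q)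
    + (\<Sum>i<Suc m. shift_op ((1 - X ^ i) * ((1 - X ^ (m - i)) * g)) (rising_binom (Suc N)) q)
    + (\<Sum>k\<in>#\<delta>. of_nat k * shift_op ((1 - X ^ (m + k)) * cyc_poly (\<delta> - {#k#})) (rising_binom (Suc N)) q)
   = q * shift_op ((1 - X ^ m) * g) (rising_binom (Suc N)) q
     + of_nat N * shift_op ((1 - X ^ Suc m) * g) (rising_binom (Suc (Suc N))) q"
proof -
  define S where "S = (\<Sum>i<Suc m. (1 - X ^ i) * (1 - X ^ (Suc m - Suc i)))"
  define J where "J = (\<Sum>k\<in>#\<delta>. of_nat k * ((1 - X ^ (m + k)) * cyc_poly (\<delta> - {#k#})))"
  define Y where "Y = X ^ m"
  have S: "(1 - X) * S = of_nat (Suc m) * (1 - X) * (1 + Y) - 2 * (1 - X * Y)"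
    unfolding S_def split_sum_two Y_def by (simp only: diff_Suc_1 power_Suc)
  have J: "J = of_nat (sum_mset \<delta>) * g - (1 - Y) * euler_deriv g"
    unfolding J_def g_def Y_def by (rule sum_mset_cyc_poly_join)
  have E: "euler_deriv ((1 - Y) * g) = (1 - Y) * euler_deriv g - of_nat m * Y * g"
    by (simp only: Y_def euler_deriv_mult euler_deriv_diff euler_deriv_1 euler_deriv_X_power)
       (simp only: algebra_simps mult_1_left mult_1_right mult_zero_left mult_zero_right diff_0 add_0 add_0_right minus_diff_eq mult_minus_left mult_minus_right add.right_inverse)
  have "of_nat N * ((1 - X * Y) * g) =
      ((1 - X) * euler_deriv ((1 - Y) * g) + (1 + of_nat (Suc N) * X) * ((1 - Y) * g))
      + ((1 - X) * S) * g + (1 - X) * J"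
    unfolding S J E N_def of_nat_Suc of_nat_add by algebra
  hence "of_nat N * ((1 - X ^ Suc m) * g) =
      ((1 - X) * euler_deriv ((1 - X ^ m) * g) + (1 + of_nat (Suc N) * X) * ((1 - X ^ m) * g))
      + (1 - X) * (S * g) + (1 - X) * J"
    by (simp only: Y_def power_Suc mult.assoc)
  hence "of_nat N * shift_op ((1 - X ^ Suc m) * g) (rising_binom (Suc (Suc N))) q =
      q * shift_op ((1 - X ^ m) * g) (rising_binom (Suc N)) q
      + shift_op (S * g) (rising_binom (Suc N)) q + shift_op J (rising_binom (Suc N)) q"
    by (simp only: shift_op_times_arg_X shift_op_of_nat_mult [symmetric] shift_op_add shift_op_one_minus_X)
  thus ?thesis
    by (simp only: S_def J_def sum_distrib_right shift_op_sum shift_op_sum_mset shift_op_of_nat_mult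
        mult.assoc diff_Suc_Suc mult_2)
       (simp only: add.assoc)
qed

lemma shift_op_X_power_mult: "shift_op (X ^ c * a) f q = shift_op a f (q - of_nat c)"
proof (induction c arbitrary: q)
  case (Suc c)
  show ?case
    by (simp only: power_Suc mult.assoc shift_op_X_mult Suc.IH) (simp add: algebra_simps)
qed (simp only: power_0 mult_1_left of_nat_0 diff_zero)

text \<open>Write \<open>X ^ c - X ^ l\<close> as
  \<open>X ^ c (1 - X ^ l) - (1 - X ^ c) X ^ l\<close> and apply the Leibniz sum to the second
  term.\<close>

lemma sum_mset_cyc_poly_remove:
  "(\<Sum>l\<in>#\<beta>. of_nat l * ((X ^ c - X ^ l) * cyc_poly (\<beta> - {#l#})))
   = of_nat (sum_mset \<beta>) * (X ^ c * cyc_poly \<beta>) + (1 - X ^ c) * euler_deriv (cyc_poly \<beta>)"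
proof -
  have "(\<Sum>l\<in>#\<beta>. of_nat l * ((X ^ c - X ^ l) * cyc_poly (\<beta> - {#l#})))
      = (\<Sum>l\<in>#\<beta>. of_nat l * (X ^ c * cyc_poly \<beta>) + - (1 - X ^ c) * (of_nat l * X ^ l * cyc_poly (\<beta> - {#l#})))"
  proof (intro arg_cong[of _ _ sum_mset] image_mset_cong)
    fix l assume "l \<in># \<beta>"
    hence "cyc_poly \<beta> = (1 - X ^ l) * cyc_poly (\<beta> - {#l#})"
      using cyc_poly_add_mset[of l "\<beta> - {#l#}"] by simp
    thus "of_nat l * ((X ^ c - X ^ l) * cyc_poly (\<beta> - {#l#}))
        = of_nat l * (X ^ c * cyc_poly \<beta>) + - (1 - X ^ c) * (of_nat l * X ^ l * cyc_poly (\<beta> - {#l#}))"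
      by (simp only:) (simp only: algebra_simps mult_1_left mult_1_right minus_diff_eq)
  qed
  also have "\<dots> = (\<Sum>l\<in>#\<beta>. of_nat l * (X ^ c * cyc_poly \<beta>))
      + - (1 - X ^ c) * (\<Sum>l\<in>#\<beta>. of_nat l * X ^ l * cyc_poly (\<beta> - {#l#}))"
    by (simp only: sum_mset.distrib sum_mset_distrib_left)
  also have "(\<Sum>l\<in>#\<beta>. of_nat l * (X ^ c * cyc_poly \<beta>)) = of_nat (sum_mset \<beta>) * (X ^ c * cyc_poly \<beta>)"
    by (simp only: sum_mset_distrib_right [symmetric] of_nat_sum_mset)
  finally show ?thesis
    unfolding sum_mset_cyc_poly_euler by (simp only: minus_mult_minus)
qed

text \<open>A part \<open>l\<close> is shortened by \<open>c\<close>. Multiplying by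
  \<open>X ^ c\<close> removes the truncated exponent \<open>l - c\<close>, and this multiplication
  is paid for by evaluating at \<open>q + c\<close>.\<close>

lemma sum_mset_shift_op_remove:
  assumes "\<And>l. l \<in># \<beta> \<Longrightarrow> c \<le> l"
  shows "(\<Sum>l\<in>#\<beta>. of_nat l * shift_op ((1 - X ^ (l - c)) * cyc_poly (\<beta> - {#l#})) f q)
    = shift_op (of_nat (sum_mset \<beta>) * (X ^ c * cyc_poly \<beta>) + (1 - X ^ c) * euler_deriv (cyc_poly \<beta>))
        f (q + of_nat c)"
proof -
  have "of_nat l * shift_op ((1 - X ^ (l - c)) * cyc_poly (\<beta> - {#l#})) f q
      = shift_op (of_nat l * ((X ^ c - X ^ l) * cyc_poly (\<beta> - {#l#}))) f (q + of_nat c)" if "l \<in># \<beta>" for l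
  proof -
    have "X ^ c * (1 - X ^ (l - c)) = X ^ c - X ^ l"
      using assms[OF that] by (simp only: right_diff_distrib mult_1_right power_add [symmetric] le_add_diff_inverse)
    hence "(X ^ c - X ^ l) * cyc_poly (\<beta> - {#l#}) = X ^ c * ((1 - X ^ (l - c)) * cyc_poly (\<beta> - {#l#}))"
      by (simp only: mult.assoc [symmetric])
    thus ?thesis
      by (simp only: shift_op_of_nat_mult shift_op_X_power_mult add_diff_cancel_right')
  qed
  hence "(\<Sum>l\<in>#\<beta>. of_nat l * shift_op ((1 - X ^ (l - c)) * cyc_poly (\<beta> - {#l#})) f q)
      = (\<Sum>l\<in>#\<beta>. shift_op (of_nat l * ((X ^ c - X ^ l) * cyc_poly (\<beta> - {#l#}))) f (q + of_nat c))"
    by (intro arg_cong[of _ _ sum_mset] image_mset_cong)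
  thus ?thesis by (simp only: shift_op_sum_mset [symmetric] sum_mset_cyc_poly_remove)
qed

text \<open>This sums the right side of \<open>two_cycle_recursion_poly\<close> over all points
  \<open>x\<close>, a part \<open>l\<close> being counted \<open>l\<close> times. Everything is
  rewritten as one operator acting on \<open>B\<close> at \<open>q + 2\<close>, which two shifts of
  \<open>U\<close> also produce.\<close>

lemma two_cycle_closed_form:
  assumes "\<And>l. l \<in># \<beta> \<Longrightarrow> 2 \<le> l" and "sum_mset \<beta> = Suc (Suc N)"
  defines "U \<equiv> shift_op (cyc_poly \<beta>) (rising_binom N)"
  shows "q * (\<Sum>l\<in>#\<beta>. of_nat l * shift_op ((1 - X ^ (l - 2)) * cyc_poly (\<beta> - {#l#})) (rising_binom (Suc N)) q)
    + of_nat N * (\<Sum>l\<in>#\<beta>. of_nat l * shift_op ((1 - X ^ (l - 1)) * cyc_poly (\<beta> - {#l#})) (rising_binom (Suc (Suc N))) q)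
    = q * ((q + 1) * U (q + 2) + (q - 1) * U (q + 1))"
proof -
  define g where "g = cyc_poly \<beta>"
  define h where "h = euler_deriv g"
  define n where "n = Suc (Suc N)"
  define B where "B = rising_binom (Suc N)"
  define B' where "B' = rising_binom (Suc (Suc N))"
  define x where "x = X"
  define a where "a = of_nat n * (x ^ 2 * g) + (1 - x ^ 2) * h"
  define a' where "a' = of_nat n * (x * g) + (1 - x) * h"
  have s1: "(\<Sum>l\<in>#\<beta>. of_nat l * shift_op ((1 - X ^ (l - 2)) * cyc_poly (\<beta> - {#l#})) (rising_binom (Suc N)) q)
      = shift_op a B (q + 2)"
    using sum_mset_shift_op_remove[of \<beta> 2 "rising_binom (Suc N)" q] assms(1)
    by (simp only: assms(2) g_def h_def n_def B_def a_def x_def of_nat_numeral)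
  have s2: "(\<Sum>l\<in>#\<beta>. of_nat l * shift_op ((1 - X ^ (l - 1)) * cyc_poly (\<beta> - {#l#})) (rising_binom (Suc (Suc N))) q)
      = shift_op a' B' (q + 1)"
    using sum_mset_shift_op_remove[of \<beta> 1 "rising_binom (Suc (Suc N))" q]
      order_trans[OF one_le_numeral assms(1)]
    by (simp only: assms(2) g_def h_def n_def B'_def a'_def x_def of_nat_1 power_one_right)
  have X1: "shift_op (x * b) f p = shift_op b f (p - 1)" for b f p
    unfolding x_def by (rule shift_op_X_mult)
  have arg: "p * U p = shift_op ((1 - x) * h + (1 + of_nat N * x) * g) B p" for p
    unfolding U_def g_def [symmetric] B_def h_def x_def by (rule shift_op_times_arg_X)
  have one: "U p = shift_op ((1 - x) * g) B p" for p
    unfolding U_def g_def [symmetric] B_def x_def by (rule shift_op_one_minus_X [symmetric])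
  have arg': "p * shift_op g B p = shift_op ((1 - x) * h + (1 + of_nat (Suc N) * x) * g) B' p" for p
    unfolding B_def B'_def h_def x_def by (rule shift_op_times_arg_X)
  have one': "shift_op g B p = shift_op ((1 - x) * g) B' p" for p
    unfolding B_def B'_def x_def by (rule shift_op_one_minus_X [symmetric])
  \<comment> \<open>Both coefficients are split to match the argument of \<open>U\<close>:
    \<open>q + 1 = (q + 2) - 1\<close> here and \<open>q - 1 = (q + 1) - 2\<close> below. The factor
    \<open>x\<close> in \<open>e2\<close> moves the evaluation from \<open>q + 1\<close> to
    \<open>q + 2\<close>.\<close>
  have e1: "(q + 1) * U (q + 2) = shift_op ((1 - x) * h + (1 + of_nat N * x) * g - (1 - x) * g) B (q + 2)"
    unfolding shift_op_diff arg [symmetric] one [symmetric] by (simp add: algebra_simps)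
  have e2: "(q - 1) * U (q + 1) =
      shift_op (x * ((1 - x) * h + (1 + of_nat N * x) * g - of_nat 2 * ((1 - x) * g))) B (q + 2)"
    unfolding X1 shift_op_diff shift_op_of_nat_mult arg [symmetric] one [symmetric] by (simp add: algebra_simps)
  have e3: "(q + 1) * U (q + 2) + (q - 1) * U (q + 1) = shift_op (a + of_nat N * (x * g)) B (q + 2)"
    unfolding e1 e2 shift_op_add [symmetric] a_def n_def
    by (rule arg_cong[of _ _ "\<lambda>b. shift_op b B (q + 2)"]) (simp add: algebra_simps power2_eq_square)
  \<comment> \<open>This shows that the second sum carries a factor \<open>q\<close>, so that
    \<open>q\<close> can be pulled out of the whole expression.\<close>
  have e4: "q * shift_op g B (q + 1) = shift_op a' B' (q + 1)"
  proof -
    have "q * shift_op g B (q + 1) = (q + 1) * shift_op g B (q + 1) - shift_op g B (q + 1)"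
      by (simp add: algebra_simps)
    also have "\<dots> = shift_op ((1 - x) * h + (1 + of_nat (Suc N) * x) * g - (1 - x) * g) B' (q + 1)"
      by (simp only: arg' [symmetric] one' [symmetric] shift_op_diff)
    also have "(1 - x) * h + (1 + of_nat (Suc N) * x) * g - (1 - x) * g = a'"
      by (simp add: a'_def n_def algebra_simps)
    finally show ?thesis .
  qed
  have "shift_op (a + of_nat N * (x * g)) B (q + 2) = shift_op a B (q + 2) + of_nat N * shift_op g B (q + 1)"
  proof -
    have "q + 2 - 1 = q + 1" by simp
    thus ?thesis by (simp only: shift_op_add shift_op_of_nat_mult X1)
  qed
  thus ?thesis
    unfolding s1 s2 e3 e4 [symmetric] by (simp add: algebra_simps)
qed

section \<open>Location of roots\<close>

lemma cmod_less_of_Re: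
  assumes "Im z = Im w" "\<bar>Re z\<bar> < \<bar>Re w\<bar>"
  shows "cmod z < cmod w"
  using assms by (simp add: cmod_def abs_le_square_iff flip: not_le)

text \<open>Nonzero constants satisfy this vacuously, but the zero polynomial does not; later
  statements therefore carry a separate alternative \<open>p = 0\<close>.\<close>

definition roots_on_line :: "real \<Rightarrow> complex poly \<Rightarrow> bool" where
  "roots_on_line c p \<longleftrightarrow> (\<forall>z. poly p z = 0 \<longrightarrow> Re z = c)"

text \<open>Factor \<open>p\<close> over the complex numbers. At equal height, the point nearer to
  the vertical line is nearer to every root, so the products of distances compare factor by
  factor.\<close>

lemma cmod_poly_less:
  assumes p: "roots_on_line c p" and deg: "degree p > 0"
    and z: "Im z = Im w" "\<bar>Re z - c\<bar> < \<bar>Re w - c\<bar>"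
  shows "cmod (poly p z) < cmod (poly p w)"
proof -
  obtain r where r: "smult (lead_coeff p) (\<Prod>i<degree p. [:- r i, 1:]) = p"
    by (rule complex_poly_decompose')
  have val: "poly p z = lead_coeff p * (\<Prod>i<degree p. z - r i)" for z
    by (subst r [symmetric]) (simp add: poly_prod)
  have "Re (r i) = c" if "i < degree p" for i
  proof -
    have "poly p (r i) = 0" unfolding val using that by force
    thus ?thesis using p by (simp add: roots_on_line_def)
  qed
  hence lt: "cmod (z - r i) < cmod (w - r i)" if "i < degree p" for i
    using that z by (intro cmod_less_of_Re) auto
  have "(\<Prod>i<degree p. cmod (z - r i)) < (\<Prod>i<degree p. cmod (w - r i))"
  proof (rule prod_mono_strict[of 0])
    show "0 < cmod (w - r i)" if "i \<in> {..<degree p}" for i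
      using that lt[of i] by (meson le_less_trans lessThan_iff norm_ge_zero)
  qed (use lt deg in \<open>auto intro: less_imp_le\<close>)
  moreover have "lead_coeff p \<noteq> 0" using deg by auto
  ultimately show ?thesis by (simp add: val norm_mult prod_norm)
qed

lemma cmod_poly_le:
  assumes "roots_on_line c p" "Im z = Im w" "\<bar>Re z - c\<bar> < \<bar>Re w - c\<bar>"
  shows "cmod (poly p z) \<le> cmod (poly p w)"
proof (cases "degree p = 0")
  case True
  then obtain k where "p = [:k:]" by (rule degree_eq_zeroE)
  thus ?thesis by simp
next
  case False
  thus ?thesis using cmod_poly_less[OF assms(1) _ assms(2,3)] by simp
qed

text \<open>At a root of \<open>R\<close> the values of \<open>p\<close> at \<open>z - 1\<close> and
  \<open>z\<close> have equal modulus. For nonconstant \<open>p\<close> these two points must then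
  be equally far from the line, that is, \<open>Re z = c + 1 / 2\<close>.\<close>

lemma roots_on_line_shift_diff:
  assumes p: "roots_on_line c p" and \<zeta>: "cmod \<zeta> = 1"
    and R: "\<And>q. poly R q = poly p (q - 1) - \<zeta> * poly p q"
  shows "R = 0 \<or> roots_on_line (c + 1 / 2) R"
proof (cases "degree p = 0")
  case True
  then obtain k where "p = [:k:]" by (rule degree_eq_zeroE)
  hence "poly R q = poly [:k - \<zeta> * k:] q" for q by (simp add: R)
  hence "R = [:k - \<zeta> * k:]" by (simp add: poly_eq_poly_eq_iff [symmetric] fun_eq_iff)
  thus ?thesis by (auto simp: roots_on_line_def)
next
  case False
  have "Re z = c + 1 / 2" if z: "poly R z = 0" for z
  proof (rule ccontr)
    assume "Re z \<noteq> c + 1 / 2"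
    hence "\<bar>Re z - c\<bar> < \<bar>Re (z - 1) - c\<bar> \<or> \<bar>Re (z - 1) - c\<bar> < \<bar>Re z - c\<bar>"
      by (simp add: abs_if) argo
    moreover have im: "Im z = Im (z - 1)" by simp
    moreover have "degree p > 0" using False by simp
    ultimately have "cmod (poly p (z - 1)) \<noteq> cmod (poly p z)"
      using cmod_poly_less[OF p] by (metis less_irrefl)
    moreover from z have "poly p (z - 1) = \<zeta> * poly p z" by (simp add: R)
    ultimately show False by (simp add: norm_mult \<zeta>)
  qed
  thus ?thesis by (simp add: roots_on_line_def)
qed

text \<open>The zeros \<open>a\<close> and \<open>b\<close> of the linear factors are symmetric
  about \<open>c + 1 / 2\<close>. Off that line, \<open>b < a\<close> makes the comparison of linear
  factors point the same way as that of \<open>p (z - 1)\<close> with \<open>p z\<close>, so the two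
  terms cannot balance. The linear factors supply strictness even for constant
  \<open>p\<close>.\<close>

lemma roots_on_line_shift_diff_linear:
  fixes a b :: real
  assumes p: "roots_on_line c p" and \<zeta>: "cmod \<zeta> = 1" and ab: "b < a" "a + b = 2 * c + 1"
    and R: "\<And>q. poly R q = (q - of_real a) * poly p (q - 1) - \<zeta> * ((q - of_real b) * poly p q)"
  shows "roots_on_line (c + 1 / 2) R"
proof -
  have "Re z = c + 1 / 2" if z: "poly R z = 0" for z
  proof (rule ccontr)
    assume ne: "Re z \<noteq> c + 1 / 2"
    have "(z - of_real a) * poly p (z - 1) = \<zeta> * ((z - of_real b) * poly p z)"
      using z by (simp add: R)
    hence eq: "cmod (z - of_real a) * cmod (poly p (z - 1)) = cmod (z - of_real b) * cmod (poly p z)"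
      by (metis norm_mult \<zeta> mult_1_left)
    show False
    proof (cases "Re z < c + 1 / 2")
      case True
      have "cmod (poly p z) \<le> cmod (poly p (z - 1))"
        using True by (intro cmod_poly_le[OF p]) auto
      moreover have "cmod (z - of_real b) < cmod (z - of_real a)"
        using True ab by (intro cmod_less_of_Re) auto
      moreover have "poly p (z - 1) \<noteq> 0"
        using p True by (auto simp: roots_on_line_def)
      ultimately have "cmod (z - of_real b) * cmod (poly p z) < cmod (z - of_real a) * cmod (poly p (z - 1))"
        by (intro order_le_less_trans[OF mult_left_mono mult_strict_right_mono]) auto
      thus False using eq by simp
    next
      case False
      with ne have gt: "Re z > c + 1 / 2" by simp
      have "cmod (poly p (z - 1)) \<le> cmod (poly p z)"
        using gt by (intro cmod_poly_le[OF p]) auto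
      moreover have "cmod (z - of_real a) < cmod (z - of_real b)"
        using gt ab by (intro cmod_less_of_Re) auto
      moreover have "poly p z \<noteq> 0"
        using p gt by (auto simp: roots_on_line_def)
      ultimately have "cmod (z - of_real a) * cmod (poly p (z - 1)) < cmod (z - of_real b) * cmod (poly p z)"
        by (intro order_le_less_trans[OF mult_left_mono mult_strict_right_mono]) auto
      thus False using eq by simp
    qed
  qed
  thus ?thesis by (simp add: roots_on_line_def)
qed

text \<open>Dividing out one root \<open>\<zeta>\<close> of \<open>a\<close> at a time: as long as linear factors of the rising
  factorial are left, the outermost two of them are traded for the next polynomial factor.\<close>

lemma shift_op_roots_on_line:
  assumes "a \<noteq> 0" "\<And>z. poly a z = 0 \<Longrightarrow> cmod z = 1"
  shows "\<exists>p. (p = 0 \<or> roots_on_line ((real (degree a) + 1 - real N) / 2) p) \<and>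
    (\<forall>q. shift_op a (rising_binom N) q = pochhammer q (N - degree a) * poly p q)"
  using assms
proof (induction "degree a" arbitrary: a)
  case 0
  then obtain c where a: "a = [:c:]" by (metis degree_eq_zeroE)
  with 0 show ?case
    by (intro exI[of _ "[:c / fact N:]"])
       (simp add: roots_on_line_def shift_op_pCons rising_binom_def)
next
  case (Suc k)
  have "\<not> constant (poly a)" using Suc.hyps(2) by (simp add: constant_degree)
  then obtain \<zeta> where \<zeta>: "poly a \<zeta> = 0" using fundamental_theorem_of_algebra by blast
  then obtain a' where a': "a = [:- \<zeta>, 1:] * a'" by (auto simp: poly_eq_0_iff_dvd dvd_def)
  have a'0: "a' \<noteq> 0" using Suc.prems a' by auto
  have deg: "degree a = Suc (degree a')" by (simp only: a') (subst degree_mult_eq, use a'0 in auto)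
  hence k: "k = degree a'" using Suc.hyps by simp
  have norm: "cmod \<zeta> = 1" using Suc.prems \<zeta> by blast
  \<comment> \<open>Each root of \<open>a\<close> moves the line to the right by
    \<open>1 / 2\<close>; \<open>c\<close> is its position before the root \<open>\<zeta>\<close> is
    restored.\<close>
  define c where "c = (real k + 1 - real N) / 2"
  have c': "(real (degree a) + 1 - real N) / 2 = c + 1 / 2"
    by (simp add: deg k c_def field_simps)
  obtain p where p: "p = 0 \<or> roots_on_line c p"
      "\<And>q. shift_op a' (rising_binom N) q = pochhammer q (N - k) * poly p q"
    using Suc.hyps(1)[OF k a'0] Suc.prems unfolding c_def k a' by auto
  have step: "shift_op a (rising_binom N) q =
      pochhammer (q - 1) (N - k) * poly p (q - 1) - \<zeta> * (pochhammer q (N - k) * poly p q)" for q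
  proof -
    have "a = smult (- \<zeta>) a' + [:0, 1:] * a'" by (simp add: a')
    thus ?thesis by (simp only: shift_op_add shift_op_smult shift_op_X_mult p(2)) (simp add: algebra_simps)
  qed
  show ?case
  proof (cases "k < N")
    case True
    then obtain m where m: "N - k = Suc m" by (metis Suc_diff_Suc)
    \<comment> \<open>The rising factorials at \<open>q - 1\<close> and \<open>q\<close> share the
      factor \<open>pochhammer q m\<close>. The factors left over are \<open>q - 1\<close> and
      \<open>q + m\<close>, with zeros \<open>1\<close> and \<open>- m\<close> whose midpoint is
      \<open>c + 1 / 2\<close>.\<close>
    define R where "R = [:-1, 1:] * pcompose p [:-1, 1:] - smult \<zeta> ([:of_nat m, 1:] * p)"
    have R: "poly R q = (q - of_real 1) * poly p (q - 1) - \<zeta> * ((q - of_real (- real m)) * poly p q)" for q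
      by (simp add: R_def poly_pcompose algebra_simps)
    have "pochhammer (q - 1) (Suc m) = (q - 1) * pochhammer q m" for q :: complex
      using pochhammer_rec[of "q - 1" m] by simp
    hence "shift_op a (rising_binom N) q = pochhammer q m * poly R q" for q
      unfolding step m R by (simp only: pochhammer_Suc) (simp add: algebra_simps)
    moreover have "R = 0 \<or> roots_on_line (c + 1 / 2) R"
    proof (cases "p = 0")
      case False
      have "real N - real k = real (Suc m)" using m True by linarith
      hence "1 + - real m = 2 * c + 1" by (simp add: c_def)
      thus ?thesis using roots_on_line_shift_diff_linear[OF _ norm, of c p "- real m" 1 R] p(1) False R by simp
    qed (simp add: R_def)
    moreover have "N - degree a = m" using m by (simp add: deg k)
    ultimately show ?thesis unfolding c' by blast
  next
    case False
    define R where "R = pcompose p [:-1, 1:] - smult \<zeta> p"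
    have R: "poly R q = poly p (q - 1) - \<zeta> * poly p q" for q
      by (simp add: R_def poly_pcompose algebra_simps)
    have "shift_op a (rising_binom N) q = pochhammer q 0 * poly R q" for q
      unfolding step R using False by simp
    moreover have "R = 0 \<or> roots_on_line (c + 1 / 2) R"
      using roots_on_line_shift_diff[OF _ norm, of c p R] p(1) R by (cases "p = 0") (auto simp: R_def)
    moreover have "N - degree a = 0" using False by (simp add: deg k)
    ultimately show ?thesis unfolding c' by (metis)
  qed
qed

section \<open>Cycle types under deletion and transposition\<close>

lemma orbit_self:
  assumes "p permutes A" "finite A"
  shows "x \<in> orbit p x"
  using assms permutation_permutes permutation_self_in_orbit by metis

lemma orbit_eq_of_mem:
  assumes "p permutes A" "finite A" "y \<in> orbit p x"
  shows "orbit p y = orbit p x"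
  by (rule orbit_cyclic_eq3[OF cyclic_on_orbit[OF assms(1,2)] assms(3)])

lemma orbit_disjoint:
  assumes "p permutes A" "finite A" "y \<notin> orbit p x"
  shows "orbit p x \<inter> orbit p y = {}"
  using assms orbit_eq_of_mem orbit_self by (metis disjoint_iff)

lemma finite_orbit_permutes:
  assumes "p permutes A" "finite A"
  shows "finite (orbit p x)"
  using finite_orbit[OF orbit_self[OF assms]] .

lemma card_orbit_eq_1_iff:
  assumes "p permutes A" "finite A"
  shows "card (orbit p x) = 1 \<longleftrightarrow> p x = x"
proof -
  have "card (orbit p x) = 1 \<longleftrightarrow> orbit p x = {x}"
    using orbit_self[OF assms, of x] by (auto simp: card_1_singleton_iff)
  thus ?thesis by (simp only: orbit_eq_singleton_iff)
qed

text \<open>Used to read off the orbits of a permutation altered by a transposition from an explicit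
  cyclic list.\<close>

lemma orbit_cyclic_enum:
  assumes "k > 0" "\<And>i. Suc i < k \<Longrightarrow> f (b i) = b (Suc i)" "f (b (k - 1)) = b 0"
  shows "orbit f (b 0) = b ` {..<k}"
proof -
  have pow: "(f ^^ i) (b 0) = b i" if "i < k" for i
    using that by (induction i) (auto simp: assms(2))
  have "(f ^^ k) (b 0) = b 0"
    using assms(1,3) pow[of "k - 1"] by (cases k) auto
  hence "orbit f (b 0) = {(f ^^ m) (b 0) | m. m < k}"
    using assms(1) by (rule orbit_altdef_bounded)
  also have "\<dots> = (\<lambda>m. (f ^^ m) (b 0)) ` {..<k}" by auto
  also have "\<dots> = b ` {..<k}" using pow by (intro image_cong) auto
  finally show ?thesis .
qed

lemma orbit_enum:
  fixes p :: "'a \<Rightarrow> 'a" and x :: 'a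
  assumes p: "p permutes A" "finite A"
  defines "a \<equiv> \<lambda>i. (p ^^ i) x" and "l \<equiv> card (orbit p x)"
  shows "orbit p x = a ` {..<l}" "inj_on a {..<l}" "a l = x" "l > 0"
proof -
  note self = orbit_self[OF p, of x]
  define d where "d = funpow_dist1 p x x"
  have img: "orbit p x = a ` {0..<d}"
    unfolding a_def d_def by (rule orbit_conv_funpow_dist1[OF self])
  have inj: "inj_on a {0..<d}"
    unfolding a_def d_def by (rule inj_on_funpow_dist1[OF self])
  have "l = d" unfolding l_def img using card_image[OF inj] by simp
  thus "orbit p x = a ` {..<l}" "inj_on a {..<l}" "a l = x" "l > 0"
    using img inj funpow_dist1_prop[OF self] by (auto simp: a_def d_def atLeast0LessThan)
qed

lemma cycle_type_on_cong:
  assumes "\<And>w. w \<in> A \<Longrightarrow> orbit p w = orbit p' w"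
  shows "cycle_type_on A p = cycle_type_on A p'"
  using assms by (simp add: cycle_type_on_def cycles_on_def cong: image_cong_simp)

lemma card_cycles_on: "card (cycles_on A p) = size (cycle_type_on A p)"
  by (simp add: cycle_type_on_def)

lemma cycle_type_on_orbit:
  assumes "p permutes A" "finite A"
  shows "cycle_type_on (orbit p x) p = {#card (orbit p x)#}"
proof -
  have "cycles_on (orbit p x) p = {orbit p x}"
    unfolding cycles_on_def using orbit_eq_of_mem[OF assms] orbit_nonempty[of p x] by blast
  thus ?thesis by (simp add: cycle_type_on_def)
qed

lemma cycle_type_on_Un:
  assumes "finite A" "finite B" "A \<inter> B = {}"
    and "\<And>a. a \<in> A \<Longrightarrow> orbit p a \<subseteq> A" "\<And>b. b \<in> B \<Longrightarrow> orbit p b \<subseteq> B"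
  shows "cycle_type_on (A \<union> B) p = cycle_type_on A p + cycle_type_on B p"
proof -
  have "orbit p a \<noteq> orbit p b" if "a \<in> A" "b \<in> B" for a b
    using that assms(3,4,5) orbit_nonempty[of p a] by blast
  hence "cycles_on A p \<inter> cycles_on B p = {}"
    unfolding cycles_on_def by blast
  moreover have "cycles_on (A \<union> B) p = cycles_on A p \<union> cycles_on B p"
    by (auto simp: cycles_on_def)
  moreover have "finite (cycles_on A p)" "finite (cycles_on B p)"
    using assms(1,2) by (simp_all add: cycles_on_def)
  ultimately show ?thesis by (simp add: cycle_type_on_def mset_set_Union)
qed

lemma cycle_type_on_remove_orbit:
  assumes p: "p permutes A" "finite A" and Y: "Y \<subseteq> A" "x \<in> Y" "\<And>y. y \<in> Y \<Longrightarrow> orbit p y \<subseteq> Y"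
  shows "cycle_type_on Y p = add_mset (card (orbit p x)) (cycle_type_on (Y - orbit p x) p)"
proof -
  have "orbit p b \<subseteq> Y - orbit p x" if "b \<in> Y - orbit p x" for b
    using that Y(3)[of b] orbit_disjoint[OF p, of b x] by auto
  moreover have "orbit p a \<subseteq> orbit p x" if "a \<in> orbit p x" for a
    using orbit_eq_of_mem[OF p that] by simp
  moreover have "orbit p x \<union> (Y - orbit p x) = Y"
    using Y(2,3) by blast
  ultimately show ?thesis
    using cycle_type_on_Un[of "orbit p x" "Y - orbit p x" p] finite_subset[OF Y(1) p(2)]
      cycle_type_on_orbit[OF p, of x] finite_orbit_permutes[OF p, of x]
    by auto
qed

text \<open>Grouping points by their cycle counts a cycle of length \<open>k\<close> exactly
  \<open>k\<close> times. This converts sums over points into sums over parts.\<close>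

lemma sum_mset_cycle_type_on:
  assumes "p permutes A" "finite A"
  shows "(\<Sum>y\<in>A. F (card (orbit p y))) = (\<Sum>k\<in>#cycle_type_on A p. of_nat k * (F k :: 'b :: comm_semiring_1))"
proof -
  have fib: "{y \<in> A. orbit p y = D} = D" if D: "D \<in> cycles_on A p" for D
  proof -
    obtain x where x: "x \<in> A" "D = orbit p x" using D by (auto simp: cycles_on_def)
    hence "D \<subseteq> A" using permutes_orbit_subset[OF assms(1)] by blast
    thus ?thesis using orbit_eq_of_mem[OF assms] orbit_self[OF assms] x(2) by blast
  qed
  have "(\<Sum>y\<in>A. F (card (orbit p y))) = (\<Sum>D\<in>cycles_on A p. \<Sum>y | y \<in> A \<and> orbit p y = D. F (card (orbit p y)))"
    using assms(2) by (intro sum.group [symmetric]) (auto simp: cycles_on_def)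
  also have "\<dots> = (\<Sum>D\<in>cycles_on A p. of_nat (card D) * F (card D))"
  proof (intro sum.cong refl)
    fix D assume "D \<in> cycles_on A p"
    have "(\<Sum>y | y \<in> A \<and> orbit p y = D. F (card (orbit p y))) = (\<Sum>y | y \<in> A \<and> orbit p y = D. F (card D))"
      by (intro sum.cong) auto
    thus "(\<Sum>y | y \<in> A \<and> orbit p y = D. F (card (orbit p y))) = of_nat (card D) * F (card D)"
      using fib[OF \<open>D \<in> _\<close>] by simp
  qed
  also have "\<dots> = (\<Sum>k\<in>#cycle_type_on A p. of_nat k * F k)"
    by (simp add: cycle_type_on_def sum_unfold_sum_mset image_mset.compositionality comp_def)
  finally show ?thesis .
qed

lemma sum_mset_cycle_type_on_remove:
  assumes p: "p permutes A" "finite A" and x: "x \<in> A"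
  shows "(\<Sum>y\<in>A - orbit p x. F (card (orbit p y)))
    = (\<Sum>k\<in>#cycle_type_on A p - {#card (orbit p x)#}. of_nat k * (F k :: 'b :: comm_ring_1))"
proof -
  have sub: "orbit p x \<subseteq> A" using permutes_orbit_subset[OF p(1) x] .
  have "(\<Sum>y\<in>orbit p x. F (card (orbit p y))) = (\<Sum>y\<in>orbit p x. F (card (orbit p x)))"
    using orbit_eq_of_mem[OF p] by (intro sum.cong) auto
  hence "(\<Sum>y\<in>A - orbit p x. F (card (orbit p y)))
      = (\<Sum>k\<in>#cycle_type_on A p. of_nat k * F k) - of_nat (card (orbit p x)) * F (card (orbit p x))"
    using sum_diff[OF p(2) sub, of "\<lambda>y. F (card (orbit p y))"] sum_mset_cycle_type_on[OF p, of F] by simp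
  moreover have "cycle_type_on A p = add_mset (card (orbit p x)) (cycle_type_on (A - orbit p x) p)"
    using x permutes_orbit_subset[OF p(1)] by (intro cycle_type_on_remove_orbit[OF p]) auto
  ultimately show ?thesis by simp
qed

lemma sum_cycle_type_on:
  assumes "p permutes A" "finite A"
  shows "sum_mset (cycle_type_on A p) = card A"
  using sum_mset_cycle_type_on[OF assms, of "\<lambda>_. 1 :: nat"] by simp

section \<open>Deleting a point from a permutation\<close>

text \<open>\<open>del x p\<close> cuts \<open>x\<close> out of its cycle and fixes it.\<close>

definition del :: "'a \<Rightarrow> ('a \<Rightarrow> 'a) \<Rightarrow> 'a \<Rightarrow> 'a" where
  "del x p = transpose x (p x) \<circ> p"

lemma del_self [simp]: "del x p x = x"
  by (simp add: del_def)

lemma del_apply: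
  assumes "inj p" "w \<noteq> x"
  shows "del x p w = (if p w = x then p x else p w)"
  using assms by (auto simp: del_def transpose_def inj_eq)

lemma del_permutes:
  assumes "p permutes A" "x \<in> A"
  shows "del x p permutes (A - {x})"
proof -
  have "del x p permutes A"
    unfolding del_def using assms by (intro permutes_compose permutes_swap_id) (auto simp: permutes_in_image)
  thus ?thesis by (rule permutes_superset) auto
qed

lemma orbit_del:
  assumes "p permutes A" "x \<in> A" "w \<noteq> x"
  shows "orbit (del x p) w = orbit p w - {x}"
proof -
  note inj = permutes_inj[OF assms(1)]
  note d = del_apply[OF inj]
  have "v \<in> orbit p w \<and> v \<noteq> x" if "v \<in> orbit (del x p) w" for v
    using that
  proof induction
    case base
    show ?case using assms(3) inj by (auto simp: d inj_eq intro: orbit.intros)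
  next
    case (step v)
    thus ?case using inj by (auto simp: d inj_eq intro: orbit.intros)
  qed
  moreover have "(v \<noteq> x \<longrightarrow> v \<in> orbit (del x p) w) \<and> (v = x \<longrightarrow> p x \<in> orbit (del x p) w)"
    if "v \<in> orbit p w" for v
    using that
  proof induction
    case base
    show ?case using assms(3) orbit.base[of "del x p" w] by (auto simp: d)
  next
    case (step v)
    thus ?case using orbit.step[of v "del x p" w] by (cases "v = x") (auto simp: d)
  qed
  ultimately show ?thesis by blast
qed

text \<open>A cycle of length 1 disappears when its point is deleted; \<open>part\<close> keeps such
  a cycle from leaving a part 0 in the cycle type.\<close>

definition part :: "nat \<Rightarrow> nat multiset" where
  "part k = (if k = 0 then {#} else {#k#})"

lemma cycle_type_on_del:
  assumes p: "p permutes A" "finite A" and x: "x \<in> A"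
  shows "cycle_type_on (A - {x}) (del x p)
    = part (card (orbit p x) - 1) + (cycle_type_on A p - {#card (orbit p x)#})"
proof -
  define C where "C = orbit p x"
  have CA: "C \<subseteq> A" unfolding C_def using permutes_orbit_subset[OF p(1) x] .
  have xC: "x \<in> C" unfolding C_def by (rule orbit_self[OF p])
  have "cycle_type_on A p = add_mset (card C) (cycle_type_on (A - C) p)"
    unfolding C_def using x permutes_orbit_subset[OF p(1)] by (intro cycle_type_on_remove_orbit[OF p]) auto
  moreover have outside: "orbit (del x p) w = orbit p w" if "w \<in> A - C" for w
    using that orbit_del[OF p(1) x, of w] orbit_disjoint[OF p, of w x] xC by (auto simp: C_def)
  hence "cycle_type_on (A - C) (del x p) = cycle_type_on (A - C) p"
    by (rule cycle_type_on_cong)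
  moreover have "cycle_type_on (A - {x}) (del x p) = part (card C - 1) + cycle_type_on (A - C) (del x p)"
  proof (cases "C = {x}")
    case True
    thus ?thesis by (simp add: part_def)
  next
    case False
    then obtain w where w: "w \<in> C" "w \<noteq> x" using xC by blast
    have "orbit (del x p) w = C - {x}"
      using orbit_del[OF p(1) x w(2)] orbit_eq_of_mem[OF p, of w x] w(1) by (simp add: C_def)
    moreover have "cycle_type_on (A - {x}) (del x p)
        = add_mset (card (orbit (del x p) w)) (cycle_type_on (A - {x} - orbit (del x p) w) (del x p))"
      using w CA p(2) permutes_orbit_subset[OF del_permutes[OF p(1) x]]
      by (intro cycle_type_on_remove_orbit[OF del_permutes[OF p(1) x]]) auto
    moreover have "A - {x} - (C - {x}) = A - C" using xC by blast
    moreover have "card (C - {x}) = card C - 1" using xC by simp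
    moreover have "card (C - {x}) \<noteq> 0"
      using w finite_orbit_permutes[OF p, of x] by (auto simp: C_def)
    ultimately show ?thesis by (simp add: part_def)
  qed
  ultimately show ?thesis by (simp add: C_def)
qed

lemma size_part: "size (part k) = (if k = 0 then 0 else 1)"
  by (simp add: part_def)

lemma card_orbit_mem_cycle_type_on:
  assumes "finite A" "x \<in> A"
  shows "card (orbit p x) \<in># cycle_type_on A p"
  using assms by (auto simp: cycle_type_on_def cycles_on_def)

lemma card_cycles_on_del:
  assumes p: "p permutes A" "finite A" and x: "x \<in> A"
  shows "card (cycles_on A p) = card (cycles_on (A - {x}) (del x p)) + (if p x = x then 1 else 0)"
proof -
  have "card (orbit p x) \<in># cycle_type_on A p"
    using p(2) x by (rule card_orbit_mem_cycle_type_on)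
  hence "size (cycle_type_on A p - {#card (orbit p x)#}) + 1 = size (cycle_type_on A p)"
    by (metis Suc_eq_plus1 insert_DiffM size_add_mset)
  moreover have "card (orbit p x) - 1 = 0 \<longleftrightarrow> p x = x"
    using card_orbit_eq_1_iff[OF p, of x] orbit_enum(4)[OF p, of x] by linarith
  ultimately show ?thesis
    unfolding card_cycles_on cycle_type_on_del[OF p x] by (simp add: size_part)
qed

text \<open>With \<open>c\<close> a cycle avoiding \<open>x\<close>, deleting \<open>x\<close> from
  a product affects only the right factor. This is what makes the induction on the ground set
  possible.\<close>

lemma del_comp:
  assumes "inj c" "c x = x"
  shows "del x (c \<circ> p) = c \<circ> del x p"
proof
  fix w
  have 1: "c z = x \<longleftrightarrow> z = x" for z using assms by (metis inj_eq)
  have 2: "c z = c z' \<longleftrightarrow> z = z'" for z z' using assms(1) by (rule inj_eq)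
  show "del x (c \<circ> p) w = (c \<circ> del x p) w"
    by (simp only: del_def comp_apply transpose_def 1 2 assms(2) if_distrib[of c])
qed

section \<open>Multiplication by a transposition: splitting and joining cycles\<close>

lemma swap_comp_permutes:
  assumes "p permutes A" "x \<in> A" "y \<in> A"
  shows "transpose x y \<circ> p permutes A"
  by (rule permutes_compose[OF assms(1) permutes_swap_id[OF assms(2,3)]])

lemma orbit_swap_comp_other:
  assumes p: "p permutes A" "finite A" and w: "x \<notin> orbit p w" "y \<notin> orbit p w"
  shows "orbit (transpose x y \<circ> p) w = orbit p w"
proof (rule orbit_cong[OF orbit_self[OF p]])
  fix s assume "s \<in> orbit p w"
  hence "p s \<noteq> x" "p s \<noteq> y" using orbit.step[of s p w] w by auto
  thus "(transpose x y \<circ> p) s = p s" by simp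
qed

text \<open>List the cycle of \<open>x\<close> as \<open>a 0, ..., a (l - 1)\<close> with
  \<open>a 0 = x\<close> and \<open>a j = y\<close>. After the swap, \<open>a (j - 1)\<close> goes
  to \<open>x\<close> and \<open>a (l - 1)\<close> goes to \<open>y\<close>, so the cycle breaks
  into the first \<open>j\<close> points and the rest. Other cycles avoid both points and are
  unchanged.\<close>

lemma swap_comp_split:
  assumes p: "p permutes A" "finite A" and x: "x \<in> A"
    and j: "0 < j" "j < card (orbit p x)"
  defines "y \<equiv> (p ^^ j) x"
  defines "r \<equiv> transpose x y \<circ> p"
  shows "card (orbit r x) = j" "card (orbit r y) = card (orbit p x) - j" "x \<notin> orbit r y"
    and "cycle_type_on A r = {#j, card (orbit p x) - j#} + (cycle_type_on A p - {#card (orbit p x)#})"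
    and "r x = x \<longleftrightarrow> j = 1"
proof -
  define a where "a = (\<lambda>i. (p ^^ i) x)"
  define l where "l = card (orbit p x)"
  have C: "orbit p x = a ` {..<l}" and inj: "inj_on a {..<l}" and al: "a l = x" and l0: "l > 0"
    using orbit_enum[OF p, of x] unfolding a_def l_def by auto
  have a0: "a 0 = x" and aj: "a j = y" by (simp_all add: a_def y_def)
  have pa: "p (a i) = a (Suc i)" for i by (simp add: a_def)
  have jl: "j < l" using j by (simp add: l_def)
  have yA: "y \<in> A"
    using permutes_orbit_subset[OF p(1) x] C jl aj by blast
  have ra: "r (a i) = (if Suc i = j then x else if Suc i = l then y else a (Suc i))" if i: "i < l" for i
  proof -
    consider "Suc i = j" | "Suc i = l" | "Suc i < l" "Suc i \<noteq> j" using i by linarith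
    thus ?thesis
    proof cases
      case 3
      hence "a (Suc i) \<noteq> a 0" "a (Suc i) \<noteq> a j"
        using inj_onD[OF inj, of "Suc i" 0] inj_onD[OF inj, of "Suc i" j] 3 jl by auto
      thus ?thesis using 3 by (simp add: r_def pa a0 aj)
    qed (use jl in \<open>auto simp: r_def pa aj al\<close>)
  qed
  have "orbit r (a 0) = a ` {..<j}"
    using j(1) jl by (intro orbit_cyclic_enum) (auto simp: ra a0)
  hence rx: "orbit r x = a ` {..<j}" by (simp add: a0)
  have "orbit r (a (j + 0)) = (\<lambda>i. a (j + i)) ` {..<l - j}"
    using j(1) jl by (intro orbit_cyclic_enum) (auto simp: ra aj)
  moreover have "(+) j ` {..<l - j} = {j..<l}"
    using image_add_atLeastLessThan[of j 0 "l - j"] jl by (simp add: atLeast0LessThan)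
  ultimately have ry: "orbit r y = a ` {j..<l}" by (simp add: aj image_image [symmetric])
  show cx: "card (orbit r x) = j"
    unfolding rx using jl by (subst card_image) (auto intro: inj_on_subset[OF inj])
  show cy: "card (orbit r y) = card (orbit p x) - j"
    unfolding ry l_def [symmetric] by (subst card_image) (auto intro: inj_on_subset[OF inj])
  show xy: "x \<notin> orbit r y"
  proof
    assume "x \<in> orbit r y"
    then obtain i where "j \<le> i" "i < l" "a 0 = a i" unfolding ry by (auto simp: a0)
    thus False using inj_onD[OF inj, of 0 i] j(1) l0 by auto
  qed
  have r: "r permutes A" unfolding r_def by (rule swap_comp_permutes[OF p(1) x yA])
  show "r x = x \<longleftrightarrow> j = 1" using card_orbit_eq_1_iff[OF r p(2), of x] cx by simp
  have un: "orbit r x \<union> orbit r y = orbit p x"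
    unfolding rx ry C using jl by (auto simp: image_Un [symmetric] ivl_disj_un)
  have yp: "y \<in> orbit p x" using un orbit_self[OF r p(2), of y] by blast
  have outside: "orbit r w = orbit p w" if "w \<in> A - orbit p x" for w
  proof -
    have "orbit p w \<inter> orbit p x = {}"
      using that orbit_disjoint[OF p, of w x] by blast
    thus ?thesis
      using orbit_self[OF p, of x] yp unfolding r_def by (intro orbit_swap_comp_other[OF p]) blast+
  qed
  have sub: "orbit r w \<subseteq> A - orbit r x" if "w \<in> A - orbit r x" for w
    using that permutes_orbit_subset[OF r, of w] orbit_disjoint[OF r p(2), of w x] by blast
  have "cycle_type_on A r = add_mset (card (orbit r x)) (cycle_type_on (A - orbit r x) r)"
    using x permutes_orbit_subset[OF r] by (intro cycle_type_on_remove_orbit[OF r p(2)]) auto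
  also have "cycle_type_on (A - orbit r x) r
      = add_mset (card (orbit r y)) (cycle_type_on (A - orbit r x - orbit r y) r)"
    using yA xy sub orbit_disjoint[OF r p(2), of x y] orbit_self[OF r p(2), of y]
    by (intro cycle_type_on_remove_orbit[OF r p(2)]) (use orbit_eq_of_mem[OF r p(2), of y x] orbit_self[OF r p(2), of x] in auto)
  also have "A - orbit r x - orbit r y = A - orbit p x" using un by blast
  also have "cycle_type_on (A - orbit p x) r = cycle_type_on (A - orbit p x) p"
    using outside by (rule cycle_type_on_cong)
  also have "\<dots> = cycle_type_on A p - {#card (orbit p x)#}"
    using cycle_type_on_remove_orbit[OF p subset_refl x] permutes_orbit_subset[OF p(1)] by simp
  finally show "cycle_type_on A r = {#j, card (orbit p x) - j#} + (cycle_type_on A p - {#card (orbit p x)#})"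
    by (simp add: cx cy)
qed

text \<open>The last point of the cycle of \<open>x\<close> now goes to \<open>y\<close>, and the
  last point of the cycle of \<open>y\<close> goes to \<open>x\<close>. The two cycles are
  concatenated, as listed by \<open>s\<close>.\<close>

lemma swap_comp_join:
  assumes p: "p permutes A" "finite A" and x: "x \<in> A" and y: "y \<in> A" "y \<notin> orbit p x"
  defines "r \<equiv> transpose x y \<circ> p"
  shows "orbit r x = orbit p x \<union> orbit p y"
    and "card (orbit r x) = card (orbit p x) + card (orbit p y)"
    and "cycle_type_on A r = add_mset (card (orbit p x) + card (orbit p y))
      (cycle_type_on A p - {#card (orbit p x)#} - {#card (orbit p y)#})"
proof -
  define a where "a = (\<lambda>i. (p ^^ i) x)"
  define b where "b = (\<lambda>i. (p ^^ i) y)"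
  define l where "l = card (orbit p x)"
  define m where "m = card (orbit p y)"
  have C: "orbit p x = a ` {..<l}" and al: "a l = x" and l0: "l > 0" and inja: "inj_on a {..<l}"
    using orbit_enum[OF p, of x] unfolding a_def l_def by auto
  have D: "orbit p y = b ` {..<m}" and bm: "b m = y" and m0: "m > 0" and injb: "inj_on b {..<m}"
    using orbit_enum[OF p, of y] unfolding b_def m_def by auto
  have a0: "a 0 = x" and b0: "b 0 = y" by (simp_all add: a_def b_def)
  have pa: "p (a i) = a (Suc i)" and pb: "p (b i) = b (Suc i)" for i
    by (simp_all add: a_def b_def)
  have CD: "orbit p x \<inter> orbit p y = {}" using orbit_disjoint[OF p y(2)] .
  have xC: "x \<in> orbit p x" "y \<in> orbit p y" using orbit_self[OF p] by auto
  have ra: "r (a i) = (if Suc i = l then y else a (Suc i))" if "i < l" for i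
  proof (cases "Suc i = l")
    case False
    hence lt: "Suc i < l" using that by simp
    hence "a (Suc i) \<in> orbit p x" unfolding C by blast
    hence "a (Suc i) \<noteq> y" using y(2) by blast
    moreover have "a (Suc i) \<noteq> a 0" using inj_onD[OF inja, of "Suc i" 0] lt by auto
    ultimately show ?thesis using False by (simp add: r_def pa a0)
  qed (auto simp: r_def pa al)
  have rb: "r (b i) = (if Suc i = m then x else b (Suc i))" if "i < m" for i
  proof (cases "Suc i = m")
    case False
    hence lt: "Suc i < m" using that by simp
    hence "b (Suc i) \<in> orbit p y" unfolding D by blast
    hence "b (Suc i) \<noteq> x" using CD xC by blast
    moreover have "b (Suc i) \<noteq> b 0" using inj_onD[OF injb, of "Suc i" 0] lt by auto
    ultimately show ?thesis using False by (simp add: r_def pb b0)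
  qed (auto simp: r_def pb bm)
  define s where "s = (\<lambda>i. if i < l then a i else b (i - l))"
  have "orbit r (s 0) = s ` {..<l + m}"
  proof (rule orbit_cyclic_enum)
    show "r (s i) = s (Suc i)" if "Suc i < l + m" for i
      using that by (auto simp: s_def ra rb b0 Suc_diff_le)
    show "r (s (l + m - 1)) = s 0"
      using rb[of "m - 1"] m0 l0 by (auto simp: s_def a0 not_less)
  qed (use l0 in auto)
  moreover have "s ` {..<l + m} = a ` {..<l} \<union> b ` {..<m}"
  proof -
    have "{..<l + m} = {..<l} \<union> (+) l ` {..<m}"
      using image_add_atLeastLessThan[of l 0 m] by (auto simp: atLeast0LessThan)
    hence "s ` {..<l + m} = s ` {..<l} \<union> (\<lambda>i. s (l + i)) ` {..<m}"
      by (simp add: image_Un image_image)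
    thus ?thesis by (simp add: s_def)
  qed
  ultimately show un: "orbit r x = orbit p x \<union> orbit p y"
    using l0 by (simp add: s_def a0 C D)
  show c: "card (orbit r x) = card (orbit p x) + card (orbit p y)"
    unfolding un using CD finite_orbit_permutes[OF p] by (intro card_Un_disjoint)
  have r: "r permutes A" unfolding r_def by (rule swap_comp_permutes[OF p(1) x y(1)])
  have outside: "orbit r w = orbit p w" if "w \<in> A - orbit p x - orbit p y" for w
  proof -
    have "x \<notin> orbit p w" "y \<notin> orbit p w"
      using that orbit_disjoint[OF p, of w x] orbit_disjoint[OF p, of w y] xC by blast+
    thus ?thesis unfolding r_def by (intro orbit_swap_comp_other[OF p])
  qed
  have "cycle_type_on A r = add_mset (card (orbit r x)) (cycle_type_on (A - orbit r x) r)"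
    using x permutes_orbit_subset[OF r] by (intro cycle_type_on_remove_orbit[OF r p(2)]) auto
  also have "A - orbit r x = A - orbit p x - orbit p y" unfolding un by blast
  also have "cycle_type_on (A - orbit p x - orbit p y) r = cycle_type_on (A - orbit p x - orbit p y) p"
    using outside by (rule cycle_type_on_cong)
  also have "\<dots> = cycle_type_on (A - orbit p x) p - {#card (orbit p y)#}"
  proof -
    have "orbit p w \<subseteq> A - orbit p x" if "w \<in> A - orbit p x" for w
      using that permutes_orbit_subset[OF p(1), of w] orbit_disjoint[OF p, of w x] by blast
    thus ?thesis
      using cycle_type_on_remove_orbit[OF p, of "A - orbit p x" y] y by auto
  qed
  also have "cycle_type_on (A - orbit p x) p = cycle_type_on A p - {#card (orbit p x)#}"
    using cycle_type_on_remove_orbit[OF p subset_refl x] permutes_orbit_subset[OF p(1)] by simp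
  finally show "cycle_type_on A r = add_mset (card (orbit p x) + card (orbit p y))
      (cycle_type_on A p - {#card (orbit p x)#} - {#card (orbit p y)#})"
    by (simp add: c)
qed

text \<open>After the split, \<open>x\<close> and \<open>y\<close> lie in different cycles of
  lengths \<open>j\<close> and \<open>card (orbit p x) - j\<close>, so each deletion shortens its
  own cycle.\<close>

lemma swap_del_split:
  assumes p: "p permutes A" "finite A" and x: "x \<in> A"
    and j: "0 < j" "j < card (orbit p x)"
  defines "y \<equiv> (p ^^ j) x"
  defines "r \<equiv> transpose x y \<circ> p"
  defines "\<delta> \<equiv> cycle_type_on A p - {#card (orbit p x)#}"
  shows "r x = x \<longleftrightarrow> j = 1"
    and "cycle_type_on (A - {x}) (del x r) = part (j - 1) + add_mset (card (orbit p x) - j) \<delta>"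
    and "del x r y = y \<longleftrightarrow> card (orbit p x) - j = 1"
    and "cycle_type_on (A - {x} - {y}) (del y (del x r)) = part (j - 1) + part (card (orbit p x) - j - 1) + \<delta>"
proof -
  note split = swap_comp_split[OF p x j, folded y_def, folded r_def]
  have yA: "y \<in> A"
  proof -
    have "y \<in> orbit p x"
      using orbit_enum(1)[OF p, of x] j by (auto simp: y_def)
    thus ?thesis using permutes_orbit_subset[OF p(1) x] by blast
  qed
  have r: "r permutes A" unfolding r_def by (rule swap_comp_permutes[OF p(1) x yA])
  have yx: "y \<noteq> x" using split(3) orbit_self[OF r p(2), of y] by auto
  show "r x = x \<longleftrightarrow> j = 1" by (rule split(5))
  show t: "cycle_type_on (A - {x}) (del x r) = part (j - 1) + add_mset (card (orbit p x) - j) \<delta>"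
    unfolding cycle_type_on_del[OF r p(2) x] split(1) split(4) \<delta>_def by simp
  have o: "orbit (del x r) y = orbit r y"
    using orbit_del[OF r x yx] split(3) by auto
  note d = del_permutes[OF r x]
  have fin: "finite (A - {x})" using p(2) by simp
  have yA': "y \<in> A - {x}" using yA yx by simp
  show "del x r y = y \<longleftrightarrow> card (orbit p x) - j = 1"
    using card_orbit_eq_1_iff[OF d fin, of y] unfolding o split(2) by simp
  show "cycle_type_on (A - {x} - {y}) (del y (del x r)) = part (j - 1) + part (card (orbit p x) - j - 1) + \<delta>"
    unfolding cycle_type_on_del[OF d fin yA'] o split(2) t by simp
qed

text \<open>Here \<open>x\<close> and \<open>y\<close> lie in the same joined cycle of length
  \<open>l + m\<close>, so the second deletion shortens what the first left over.\<close>

lemma swap_del_join: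
  assumes p: "p permutes A" "finite A" and x: "x \<in> A" and y: "y \<in> A" "y \<notin> orbit p x"
  defines "r \<equiv> transpose x y \<circ> p"
  defines "l \<equiv> card (orbit p x)" and "m \<equiv> card (orbit p y)"
  defines "\<delta> \<equiv> cycle_type_on A p - {#card (orbit p x)#}"
  shows "r x \<noteq> x"
    and "cycle_type_on (A - {x}) (del x r) = add_mset (l + m - 1) (\<delta> - {#m#})"
    and "del x r y = y \<longleftrightarrow> l + m = 2"
    and "cycle_type_on (A - {x} - {y}) (del y (del x r)) = part (l + m - 2) + (\<delta> - {#m#})"
proof -
  note join = swap_comp_join[OF p x y, folded r_def]
  have r: "r permutes A" unfolding r_def by (rule swap_comp_permutes[OF p(1) x y(1)])
  have yx: "y \<noteq> x" using y(2) orbit_self[OF p, of x] by auto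
  have lm: "l > 0" "m > 0" unfolding l_def m_def using orbit_enum(4)[OF p] by auto
  have c: "card (orbit r x) = l + m" using join(2) by (simp add: l_def m_def)
  show "r x \<noteq> x" using card_orbit_eq_1_iff[OF r p(2), of x] c lm by auto
  show t: "cycle_type_on (A - {x}) (del x r) = add_mset (l + m - 1) (\<delta> - {#m#})"
    unfolding cycle_type_on_del[OF r p(2) x] c join(3) using lm
    by (simp add: \<delta>_def l_def m_def part_def)
  have "orbit r y = orbit r x"
    using join(1) orbit_self[OF p, of y] by (intro orbit_eq_of_mem[OF r p(2)]) auto
  hence o: "orbit (del x r) y = orbit r x - {x}"
    using orbit_del[OF r x yx] by simp
  have co: "card (orbit (del x r) y) = l + m - 1"
    unfolding o using orbit_self[OF r p(2), of x] c by simp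
  note d = del_permutes[OF r x]
  have fin: "finite (A - {x})" using p(2) by simp
  have yA': "y \<in> A - {x}" using y(1) yx by simp
  show "del x r y = y \<longleftrightarrow> l + m = 2"
    using card_orbit_eq_1_iff[OF d fin, of y] lm unfolding co by linarith
  show "cycle_type_on (A - {x} - {y}) (del y (del x r)) = part (l + m - 2) + (\<delta> - {#m#})"
    unfolding cycle_type_on_del[OF d fin yA'] co t by (simp add: numeral_2_eq_2)
qed

section \<open>Products with long cycles\<close>

text \<open>On a singleton this is the identity alone. On the empty set it is empty, because
  \<open>cycles_on\<close> then has no members; so the existence of a long cycle shows that its set
  is nonempty.\<close>

definition long_cycles :: "'a set \<Rightarrow> ('a \<Rightarrow> 'a) set" where
  "long_cycles A = {c. c permutes A \<and> cycles_on A c = {A}}"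

definition long_sum :: "'a set \<Rightarrow> ('a \<Rightarrow> 'a) \<Rightarrow> complex \<Rightarrow> complex" where
  "long_sum A p q = (\<Sum>c\<in>long_cycles A. q ^ card (cycles_on A (c \<circ> p)))"

lemma finite_long_cycles: "finite A \<Longrightarrow> finite (long_cycles A)"
  unfolding long_cycles_def by (rule finite_subset[OF _ finite_permutations[of A]]) auto

lemma long_cycles_permutes: "c \<in> long_cycles A \<Longrightarrow> c permutes A"
  by (simp add: long_cycles_def)

lemma orbit_long_cycles: "c \<in> long_cycles A \<Longrightarrow> w \<in> A \<Longrightarrow> orbit c w = A"
  by (auto simp: long_cycles_def cycles_on_def)

lemma long_cyclesI:
  assumes "c permutes A" "A \<noteq> {}" "\<And>w. w \<in> A \<Longrightarrow> orbit c w = A"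
  shows "c \<in> long_cycles A"
  using assms by (auto simp: long_cycles_def cycles_on_def)

text \<open>Conjugation by \<open>c\<close> turns the transposition of \<open>x\<close> and
  \<open>y\<close> into that of \<open>c x\<close> and \<open>x\<close>, so it can be moved to the
  left of \<open>c\<close>, where it is the transposition of \<open>del\<close>.\<close>

lemma comp_transpose_eq_del:
  assumes "bij c" "c y = x"
  shows "c \<circ> transpose x y = del x c"
proof -
  have "inv c x = y" "inv c (c x) = x" using assms by (auto simp: bij_def inv_f_eq)
  thus ?thesis
    unfolding del_def using transpose_comp_eq[OF assms(1), of x "c x"] by (simp add: transpose_commute)
qed

lemma del_long_cycles:
  assumes c: "c \<in> long_cycles A" and x: "x \<in> A" and ne: "A \<noteq> {x}"
  shows "del x c \<in> long_cycles (A - {x})" "c x \<noteq> x"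
proof -
  note p = long_cycles_permutes[OF c]
  show "del x c \<in> long_cycles (A - {x})"
    using x ne orbit_del[OF p x] orbit_long_cycles[OF c]
    by (intro long_cyclesI del_permutes[OF p x]) auto
  show "c x \<noteq> x"
    using orbit_long_cycles[OF c x] ne by (metis orbit_eq_singleton_iff)
qed

text \<open>The product inserts \<open>x\<close> into the cycle \<open>c\<close> between
  \<open>y\<close> and \<open>c y\<close>.\<close>

lemma comp_transpose_long_cycles:
  assumes "finite A" and c: "c \<in> long_cycles (A - {x})" and x: "x \<in> A" and y: "y \<in> A - {x}"
  shows "c \<circ> transpose x y \<in> long_cycles A"
proof (rule long_cyclesI)
  define d where "d = c \<circ> transpose x y"
  have cp: "c permutes A - {x}" using c by (rule long_cycles_permutes)
  hence cx: "c x = x" by (auto simp: permutes_def)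
  have d: "d permutes A"
    unfolding d_def using x y by (intro permutes_compose[OF permutes_swap_id permutes_subset[OF cp]]) auto
  thus "c \<circ> transpose x y permutes A" by (simp add: d_def)
  have dy: "d y = x" by (simp add: d_def cx)
  have "del x d = d \<circ> transpose x y" using comp_transpose_eq_del[OF permutes_bij[OF d] dy] by simp
  also have "\<dots> = c" by (simp add: d_def comp_assoc)
  finally have del: "del x d = c" .
  have other: "orbit d w = A" if w: "w \<in> A - {x}" for w
  proof -
    have "orbit d w - {x} = A - {x}"
      using orbit_del[OF d x, of w] orbit_long_cycles[OF c w] w by (simp add: del)
    moreover from this have "d y \<in> orbit d w" using y by (intro orbit.step) blast
    ultimately show ?thesis using x dy by auto
  qed
  show "orbit (c \<circ> transpose x y) w = A" if "w \<in> A" for w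
  proof (cases "w = x")
    case True
    have "x \<in> orbit d y" using other[OF y] x by simp
    hence "orbit d x = orbit d y" by (rule orbit_eq_of_mem[OF d assms(1)])
    thus ?thesis using True other[OF y] by (simp add: d_def)
  next
    case False
    thus ?thesis using other[of w] that by (simp add: d_def)
  qed
qed (use x in auto)

text \<open>A long cycle on \<open>A\<close> is determined by the predecessor \<open>y\<close> of
  \<open>x\<close> and by the cycle left after deleting \<open>x\<close>. The previous two lemmas
  make these assignments mutually inverse.\<close>

lemma sum_long_cycles_rec:
  assumes fin: "finite A" and x: "x \<in> A" and ne: "A \<noteq> {x}"
  shows "(\<Sum>c\<in>long_cycles A. h c) = (\<Sum>y\<in>A - {x}. \<Sum>c\<in>long_cycles (A - {x}). h (c \<circ> transpose x y))"
proof -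
  have "(\<Sum>y\<in>A - {x}. \<Sum>c\<in>long_cycles (A - {x}). h (c \<circ> transpose x y))
      = (\<Sum>(y, c)\<in>(A - {x}) \<times> long_cycles (A - {x}). h (c \<circ> transpose x y))"
    by (rule sum.cartesian_product)
  also have "\<dots> = (\<Sum>c\<in>long_cycles A. h c)"
  proof (rule sum.reindex_bij_witness[where j = "\<lambda>(y, c). c \<circ> transpose x y" and i = "\<lambda>c. (inv c x, del x c)"])
    fix yc assume "yc \<in> (A - {x}) \<times> long_cycles (A - {x})"
    then obtain y c where yc: "yc = (y, c)" and y: "y \<in> A - {x}" and c: "c \<in> long_cycles (A - {x})" by auto
    have d: "c \<circ> transpose x y \<in> long_cycles A"
      using comp_transpose_long_cycles[OF fin c x y] .
    have cx: "c x = x" using long_cycles_permutes[OF c] by (auto simp: permutes_def)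
    note bij = permutes_bij[OF long_cycles_permutes[OF d]]
    have dy: "(c \<circ> transpose x y) y = x" by (simp add: cx)
    have "inv (c \<circ> transpose x y) x = y" using bij dy by (auto simp: bij_def intro: inv_f_eq)
    moreover have "del x (c \<circ> transpose x y) = c"
      unfolding comp_transpose_eq_del[OF bij dy, symmetric]
      by (simp only: comp_assoc transpose_comp_involutory comp_id)
    ultimately show "(\<lambda>c. (inv c x, del x c)) ((\<lambda>(y, c). c \<circ> transpose x y) yc) = yc"
      by (simp add: yc)
    show "(\<lambda>(y, c). c \<circ> transpose x y) yc \<in> long_cycles A" using d by (simp add: yc)
    show "h ((\<lambda>(y, c). c \<circ> transpose x y) yc) = (case yc of (y, c) \<Rightarrow> h (c \<circ> transpose x y))"
      by (simp add: yc)
  next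
    fix c assume c: "c \<in> long_cycles A"
    note p = long_cycles_permutes[OF c]
    note bij = permutes_bij[OF p]
    have y: "c (inv c x) = x" using bij by (simp add: bij_is_surj surj_f_inv_f)
    have "inv c x \<in> A" using permutes_in_image[OF permutes_inv[OF p]] x by simp
    moreover have "inv c x \<noteq> x" using y del_long_cycles(2)[OF c x ne] by metis
    ultimately show "(inv c x, del x c) \<in> (A - {x}) \<times> long_cycles (A - {x})"
      using del_long_cycles(1)[OF c x ne] by simp
    have "del x c \<circ> transpose x (inv c x) = c"
      using comp_transpose_eq_del[OF bij y, symmetric] by (simp add: comp_assoc)
    thus "(\<lambda>(y, c). c \<circ> transpose x y) (inv c x, del x c) = c" by simp
  qed
  finally show ?thesis ..
qed

lemma power_card_cycles_on_del:
  fixes q :: "'b :: comm_monoid_mult"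
  assumes r: "r permutes A" "finite A" and x: "x \<in> A" and c: "c permutes A - {x}"
  shows "q ^ card (cycles_on A (c \<circ> r)) = (if r x = x then q else 1) * q ^ card (cycles_on (A - {x}) (c \<circ> del x r))"
proof -
  have cx: "c x = x" using c by (auto simp: permutes_def)
  have cr: "c \<circ> r permutes A"
    using r(1) permutes_subset[OF c] by (intro permutes_compose[of r A c]) auto
  have "c (r x) = x \<longleftrightarrow> r x = x" using permutes_inj[OF c] cx by (metis inj_eq)
  thus ?thesis
    using card_cycles_on_del[OF cr r(2) x] del_comp[OF permutes_inj[OF c] cx, of r]
    by (auto simp: mult.commute)
qed

text \<open>The transposition from \<open>sum_long_cycles_rec\<close> is regrouped with
  \<open>p\<close>. Deleting \<open>x\<close> from the result then loses a cycle, hence a factor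
  \<open>q\<close>, exactly when \<open>x\<close> has become a fixed point.\<close>

lemma long_sum_rec:
  assumes p: "p permutes A" "finite A" and x: "x \<in> A" and ne: "A \<noteq> {x}"
  shows "long_sum A p q = (\<Sum>y\<in>A - {x}. (if (transpose x y \<circ> p) x = x then q else 1) *
    long_sum (A - {x}) (del x (transpose x y \<circ> p)) q)"
  unfolding long_sum_def sum_long_cycles_rec[OF p(2) x ne] sum_distrib_left
proof (intro sum.cong refl)
  fix y c assume y: "y \<in> A - {x}" and c: "c \<in> long_cycles (A - {x})"
  have "transpose x y \<circ> p permutes A" using swap_comp_permutes[OF p(1) x] y by blast
  from power_card_cycles_on_del[OF this p(2) x long_cycles_permutes[OF c], of q]
  show "q ^ card (cycles_on A (c \<circ> transpose x y \<circ> p)) =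
      (if (transpose x y \<circ> p) x = x then q else 1) *
      q ^ card (cycles_on (A - {x}) (c \<circ> del x (transpose x y \<circ> p)))"
    by (simp only: comp_assoc)
qed

text \<open>Separates the \<open>y\<close> that split the cycle of \<open>x\<close> from those that
  join another cycle to it. The exponent starts at 1 because \<open>y = x\<close> is
  excluded.\<close>

lemma sum_remove_split_orbit:
  assumes p: "p permutes A" "finite A" and x: "x \<in> A" and l: "card (orbit p x) = Suc m"
  shows "(\<Sum>y\<in>A - {x}. F y) = (\<Sum>i<m. F ((p ^^ Suc i) x)) + (\<Sum>y\<in>A - orbit p x. F y)"
proof -
  define a where "a = (\<lambda>i. (p ^^ i) x)"
  have C: "orbit p x = a ` {..<Suc m}" and inj: "inj_on a {..<Suc m}"
    using orbit_enum(1,2)[OF p, of x] unfolding l a_def by simp_all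
  have a0: "a 0 = x" by (simp add: a_def)
  have "{..<Suc m} = insert 0 (Suc ` {..<m})" by (rule lessThan_Suc_eq_insert_0)
  hence "orbit p x = insert x ((\<lambda>i. a (Suc i)) ` {..<m})" by (simp add: C a0 image_image)
  moreover have inj': "inj_on (\<lambda>i. a (Suc i)) {..<m}"
    using inj by (auto simp: inj_on_def)
  moreover have "x \<notin> (\<lambda>i. a (Suc i)) ` {..<m}"
    using inj_onD[OF inj, of 0] by (auto simp: a0)
  ultimately have C': "orbit p x - {x} = (\<lambda>i. a (Suc i)) ` {..<m}" by auto
  have "A - {x} = (orbit p x - {x}) \<union> (A - orbit p x)"
    using permutes_orbit_subset[OF p(1) x] x orbit_self[OF p, of x] by auto
  moreover have "finite (orbit p x)" by (rule finite_orbit_permutes[OF p])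
  ultimately have "(\<Sum>y\<in>A - {x}. F y) = (\<Sum>y\<in>orbit p x - {x}. F y) + (\<Sum>y\<in>A - orbit p x. F y)"
    using p(2) by (simp only:) (intro sum.union_disjoint; auto)
  also have "(\<Sum>y\<in>orbit p x - {x}. F y) = (\<Sum>i<m. F (a (Suc i)))"
    unfolding C' using inj' by (simp add: sum.reindex)
  finally show ?thesis by (simp add: a_def)
qed

lemma cyc_poly_part:
  "cyc_poly (part k + \<delta>) = (if k = 0 then cyc_poly \<delta> else (1 - X ^ k) * cyc_poly \<delta>)"
  by (simp add: part_def cyc_poly_add_mset)

text \<open>Both sides satisfy one recursion: deleting a point gives splits and joins on the left,
  and \<open>long_cycle_recursion_poly\<close> treats the right. Its coefficient
  \<open>Suc N\<close> raises the factorial. On a singleton both sides equal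
  \<open>q\<close>.\<close>

theorem long_sum_eq:
  assumes "p permutes A" "finite A" "card A = Suc N"
  shows "long_sum A p q = fact N * shift_op (cyc_poly (cycle_type_on A p)) (rising_binom (Suc (Suc N))) q"
  using assms
proof (induction N arbitrary: A p)
  case 0
  then obtain x where A: "A = {x}" by (auto simp: card_1_singleton_iff)
  have perm: "c permutes {x} \<longleftrightarrow> c = id" for c :: "'a \<Rightarrow> 'a" by (rule permutes_sing)
  have orb: "orbit id x = {x}" by (simp add: orbit_eq_singleton_iff)
  have "long_cycles {x} = {id}" by (auto simp: long_cycles_def perm cycles_on_def orb)
  moreover have "p = id" using 0 by (simp add: A perm)
  moreover have "shift_op (1 - X ^ 1) (rising_binom (Suc (Suc 0))) q = q"
    using shift_op_one_minus_X[of 1 "Suc 0" q]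
    by (simp only: power_one_right mult_1_right) (simp add: shift_op_def rising_binom_def)
  ultimately show ?case
    by (simp add: A long_sum_def cycle_type_on_def cycles_on_def orb orb[unfolded id_def] cyc_poly_add_mset)
next
  case (Suc N)
  note p = Suc.prems(1,2)
  obtain x where x: "x \<in> A" using Suc.prems(3) by fastforce
  have ne: "A \<noteq> {x}" using Suc.prems(3) by auto
  have card: "card (A - {x}) = Suc N" using Suc.prems x by simp
  define \<delta> where "\<delta> = cycle_type_on A p - {#card (orbit p x)#}"
  define g where "g = cyc_poly \<delta>"
  define B where "B = rising_binom (Suc (Suc N))"
  obtain m where m: "card (orbit p x) = Suc m"
    using orbit_enum(4)[OF p, of x] by (metis not0_implies_Suc less_numeral_extra(3))
  have type: "cycle_type_on A p = add_mset (Suc m) \<delta>"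
    using card_orbit_mem_cycle_type_on[OF p(2) x, of p] by (simp add: \<delta>_def m)
  have total: "m + sum_mset \<delta> = Suc N"
    using sum_cycle_type_on[OF p] Suc.prems(3) by (simp add: type)
  define F where "F = (\<lambda>y. (if (transpose x y \<circ> p) x = x then q else 1) *
    long_sum (A - {x}) (del x (transpose x y \<circ> p)) q)"
  have IH: "long_sum (A - {x}) (del x (transpose x y \<circ> p)) q
      = fact N * shift_op (cyc_poly (cycle_type_on (A - {x}) (del x (transpose x y \<circ> p)))) B q" if "y \<in> A" for y
    unfolding B_def using p(2) card
    by (intro Suc.IH del_permutes[OF swap_comp_permutes[OF p(1) x that] x]) auto
  \<comment> \<open>For \<open>i = 0\<close> the point \<open>x\<close> becomes fixed: there is a
    factor \<open>q\<close> and no part of length \<open>i\<close>. The general term then vanishes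
    because \<open>1 - X ^ 0 = 0\<close>, so a single formula covers all \<open>i\<close>.\<close>
  have same: "F ((p ^^ Suc i) x) = fact N * ((if i = 0 then q * shift_op ((1 - X ^ m) * g) B q else 0)
      + shift_op ((1 - X ^ i) * ((1 - X ^ (m - i)) * g)) B q)" if "i < m" for i
  proof -
    define y where "y = (p ^^ Suc i) x"
    have j: "0 < Suc i" "Suc i < card (orbit p x)" using that by (auto simp: m)
    note s = swap_del_split(1,2)[OF p x j, folded y_def \<delta>_def, unfolded m]
    have "y \<in> A" unfolding y_def by (rule permutes_in_funpow_image[OF p(1) x])
    hence "F y = (if i = 0 then q else 1) *
        (fact N * shift_op (cyc_poly (part i + add_mset (m - i) \<delta>)) B q)"
      unfolding F_def IH[OF \<open>y \<in> A\<close>] s by simp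
    thus ?thesis
      by (simp add: y_def cyc_poly_part cyc_poly_add_mset g_def
          mult.left_commute[of "1 - X ^ (m - i)" "1 - X ^ i"])
  qed
  have other: "F y = fact N * shift_op ((1 - X ^ (m + card (orbit p y))) * cyc_poly (\<delta> - {#card (orbit p y)#})) B q"
    if "y \<in> A - orbit p x" for y
  proof -
    have y: "y \<in> A" "y \<notin> orbit p x" using that by auto
    note s = swap_del_join(1,2)[OF p x y, folded \<delta>_def, unfolded m]
    show ?thesis unfolding F_def IH[OF y(1)] s(2) using s(1) by (simp add: cyc_poly_add_mset)
  qed
  have "long_sum A p q = (\<Sum>i<m. F ((p ^^ Suc i) x)) + (\<Sum>y\<in>A - orbit p x. F y)"
    unfolding long_sum_rec[OF p x ne] F_def [symmetric] by (rule sum_remove_split_orbit[OF p x m])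
  also have "(\<Sum>i<m. F ((p ^^ Suc i) x)) = fact N * ((\<Sum>i<m. if i = 0 then q * shift_op ((1 - X ^ m) * g) B q else 0)
      + (\<Sum>i<m. shift_op ((1 - X ^ i) * ((1 - X ^ (m - i)) * g)) B q))"
    unfolding sum.distrib [symmetric] sum_distrib_left by (intro sum.cong refl) (rule same, simp)
  \<comment> \<open>If \<open>m = 0\<close> the sum is empty and the right side is zero as well,
    again by \<open>1 - X ^ 0 = 0\<close>.\<close>
  also have "(\<Sum>i<m. if i = 0 then q * shift_op ((1 - X ^ m) * g) B q else 0) = q * shift_op ((1 - X ^ m) * g) B q"
    by (cases "m = 0") (auto simp: sum.delta)
  also have "(\<Sum>y\<in>A - orbit p x. F y) =
      fact N * (\<Sum>k\<in>#\<delta>. of_nat k * shift_op ((1 - X ^ (m + k)) * cyc_poly (\<delta> - {#k#})) B q)"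
    unfolding \<delta>_def sum_mset_cycle_type_on_remove[OF p x, symmetric] sum_distrib_left
    by (intro sum.cong refl) (simp only: other \<delta>_def)
  finally have "long_sum A p q = fact N * (of_nat (Suc N) * shift_op ((1 - X ^ Suc m) * g) (rising_binom (Suc (Suc (Suc N)))) q)"
    using long_cycle_recursion_poly[of m \<delta> q] unfolding total g_def B_def by (simp only: distrib_left add.assoc)
  thus ?case by (simp add: type cyc_poly_add_mset g_def)
qed

section \<open>Products with a transposition and a disjoint long cycle\<close>

lemma two_cycle_long_sum:
  assumes p: "p permutes A" "finite A" and x: "x \<in> A"
    and card: "card A = Suc (Suc (Suc M))" and l: "card (orbit p x) \<ge> 3"
  defines "\<delta> \<equiv> cycle_type_on A p - {#card (orbit p x)#}"
  shows "(\<Sum>y\<in>A - {x}. \<Sum>c\<in>long_cycles (A - {x} - {y}). q ^ card (cycles_on A (c \<circ> transpose x y \<circ> p)))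
    = fact M * (q * shift_op ((1 - X ^ (card (orbit p x) - 2)) * cyc_poly \<delta>) (rising_binom (Suc (Suc M))) q
        + of_nat (Suc M) * shift_op ((1 - X ^ (card (orbit p x) - 1)) * cyc_poly \<delta>) (rising_binom (Suc (Suc (Suc M)))) q)"
proof -
  define g where "g = cyc_poly \<delta>"
  define B where "B = rising_binom (Suc (Suc M))"
  \<comment> \<open>Positivity of \<open>m\<close> keeps the split that isolates \<open>x\<close>
    (\<open>i = 0\<close>) distinct from the one that isolates \<open>y\<close>
    (\<open>i = m\<close>), so no term acquires two factors \<open>q\<close>.\<close>
  obtain m where m: "card (orbit p x) = Suc (Suc m)" and m0: "m > 0"
    using l by (metis Suc_le_D Suc_le_lessD numeral_3_eq_3 Suc_le_mono)
  have type: "cycle_type_on A p = add_mset (Suc (Suc m)) \<delta>"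
    using card_orbit_mem_cycle_type_on[OF p(2) x, of p] by (simp add: \<delta>_def m)
  have total: "m + sum_mset \<delta> = Suc M"
    using sum_cycle_type_on[OF p] card by (simp add: type)
  define r where "r = (\<lambda>y. transpose x y \<circ> p)"
  \<comment> \<open>The long cycle avoids both points, so \<open>x\<close> and then \<open>y\<close>
    can be deleted, each giving a factor \<open>q\<close> if it is fixed at that stage.\<close>
  define F where "F = (\<lambda>y. (if r y x = x then q else 1) * ((if del x (r y) y = y then q else 1) *
    long_sum (A - {x} - {y}) (del y (del x (r y))) q))"
  have F: "(\<Sum>c\<in>long_cycles (A - {x} - {y}). q ^ card (cycles_on A (c \<circ> transpose x y \<circ> p))) = F y"
    if y: "y \<in> A - {x}" for y
    unfolding F_def long_sum_def sum_distrib_left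
  proof (intro sum.cong refl)
    fix c assume "c \<in> long_cycles (A - {x} - {y})"
    hence c: "c permutes A - {x} - {y}" by (rule long_cycles_permutes)
    hence c': "c permutes A - {x}" by (rule permutes_subset) auto
    have r: "r y permutes A" unfolding r_def using swap_comp_permutes[OF p(1) x] y by blast
    have "finite (A - {x})" using p(2) by simp
    note power_card_cycles_on_del[OF r p(2) x c', of q]
      power_card_cycles_on_del[OF del_permutes[OF r x] this y c, of q]
    thus "q ^ card (cycles_on A (c \<circ> transpose x y \<circ> p)) = (if r y x = x then q else 1) *
        ((if del x (r y) y = y then q else 1) * q ^ card (cycles_on (A - {x} - {y}) (c \<circ> del y (del x (r y)))))"
      by (simp only: r_def comp_assoc)
  qed
  have P: "long_sum (A - {x} - {y}) (del y (del x (r y))) q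
      = fact M * shift_op (cyc_poly (cycle_type_on (A - {x} - {y}) (del y (del x (r y))))) B q"
    if y: "y \<in> A - {x}" for y
    unfolding B_def
  proof (rule long_sum_eq)
    have "r y permutes A" unfolding r_def using swap_comp_permutes[OF p(1) x] y by blast
    thus "del y (del x (r y)) permutes A - {x} - {y}" using x y by (intro del_permutes)
    show "card (A - {x} - {y}) = Suc M" using card p(2) x y by simp
  qed (use p(2) in simp)
  have same: "F ((p ^^ Suc i) x) = fact M * ((if i = 0 then q * shift_op ((1 - X ^ m) * g) B q else 0)
      + (if i = m then q * shift_op ((1 - X ^ m) * g) B q else 0)
      + shift_op ((1 - X ^ i) * ((1 - X ^ (m - i)) * g)) B q)" if "i < Suc m" for i
  proof -
    define y where "y = (p ^^ Suc i) x"
    have j: "0 < Suc i" "Suc i < card (orbit p x)" using that by (auto simp: m)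
    note s = swap_del_split(1,3,4)[OF p x j, folded y_def \<delta>_def, folded r_def[THEN fun_cong, of y], unfolded m]
    have "y \<in> A" unfolding y_def by (rule permutes_in_funpow_image[OF p(1) x])
    moreover have "y \<noteq> x"
      using inj_onD[OF orbit_enum(2)[OF p, of x], of "Suc i" 0] j by (auto simp: y_def)
    ultimately have "F y = (if i = 0 then q else 1) * ((if i = m then q else 1) *
        (fact M * shift_op (cyc_poly (part i + (part (m - i) + \<delta>))) B q))"
      unfolding F_def using P[of y] s that by (auto simp: add.assoc)
    also have "\<dots> = fact M * ((if i = 0 then q * shift_op ((1 - X ^ m) * g) B q else 0)
      + (if i = m then q * shift_op ((1 - X ^ m) * g) B q else 0)
      + shift_op ((1 - X ^ i) * ((1 - X ^ (m - i)) * g)) B q)"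
      using m0 that by (auto simp: cyc_poly_part g_def)
    finally show ?thesis by (simp only: y_def)
  qed
  have other: "F y = fact M * shift_op ((1 - X ^ (m + card (orbit p y))) * cyc_poly (\<delta> - {#card (orbit p y)#})) B q"
    if "y \<in> A - orbit p x" for y
  proof -
    have y: "y \<in> A" "y \<notin> orbit p x" using that by auto
    have "y \<noteq> x" using y orbit_self[OF p, of x] by auto
    note s = swap_del_join(1,3,4)[OF p x y, folded \<delta>_def, folded r_def[THEN fun_cong, of y], unfolded m]
    show ?thesis unfolding F_def using P[of y] s m0 y \<open>y \<noteq> x\<close> by (simp add: cyc_poly_part)
  qed
  have "(\<Sum>y\<in>A - {x}. \<Sum>c\<in>long_cycles (A - {x} - {y}). q ^ card (cycles_on A (c \<circ> transpose x y \<circ> p)))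
      = (\<Sum>y\<in>A - {x}. F y)"
    by (intro sum.cong refl F)
  also have "\<dots> = (\<Sum>i<Suc m. F ((p ^^ Suc i) x)) + (\<Sum>y\<in>A - orbit p x. F y)"
    by (rule sum_remove_split_orbit[OF p x m])
  also have "(\<Sum>i<Suc m. F ((p ^^ Suc i) x)) = fact M * ((\<Sum>i<Suc m. if i = 0 then q * shift_op ((1 - X ^ m) * g) B q else 0)
      + (\<Sum>i<Suc m. if i = m then q * shift_op ((1 - X ^ m) * g) B q else 0)
      + (\<Sum>i<Suc m. shift_op ((1 - X ^ i) * ((1 - X ^ (m - i)) * g)) B q))"
    unfolding sum.distrib [symmetric] sum_distrib_left by (intro sum.cong refl) (rule same, simp)
  also have "(\<Sum>i<Suc m. if i = 0 then q * shift_op ((1 - X ^ m) * g) B q else 0) = q * shift_op ((1 - X ^ m) * g) B q"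
    by (subst sum.delta) auto
  also have "(\<Sum>i<Suc m. if i = m then q * shift_op ((1 - X ^ m) * g) B q else 0) = q * shift_op ((1 - X ^ m) * g) B q"
    by (subst sum.delta) auto
  also have "(\<Sum>y\<in>A - orbit p x. F y) =
      fact M * (\<Sum>k\<in>#\<delta>. of_nat k * shift_op ((1 - X ^ (m + k)) * cyc_poly (\<delta> - {#k#})) B q)"
    unfolding \<delta>_def sum_mset_cycle_type_on_remove[OF p x, symmetric] sum_distrib_left
    by (intro sum.cong refl) (simp only: other \<delta>_def)
  finally show ?thesis
    using two_cycle_recursion_poly[of q m \<delta>] unfolding total g_def B_def m
    by (simp only: distrib_left [symmetric] mult_2 diff_Suc_1 diff_Suc_Suc numeral_2_eq_2 diff_zero)
qed

lemma two_cycle_total_sum: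
  assumes p: "p permutes A" "finite A" and card: "card A = Suc (Suc (Suc M))"
    and ge: "\<And>k. k \<in># cycle_type_on A p \<Longrightarrow> 3 \<le> k"
  defines "U \<equiv> shift_op (cyc_poly (cycle_type_on A p)) (rising_binom (Suc M))"
  shows "(\<Sum>x\<in>A. \<Sum>y\<in>A - {x}. \<Sum>c\<in>long_cycles (A - {x} - {y}). q ^ card (cycles_on A (c \<circ> transpose x y \<circ> p)))
    = fact M * (q * ((q + 1) * U (q + 2) + (q - 1) * U (q + 1)))"
proof -
  define \<beta> where "\<beta> = cycle_type_on A p"
  define V where "V = (\<lambda>l. shift_op ((1 - X ^ (l - 2)) * cyc_poly (\<beta> - {#l#})) (rising_binom (Suc (Suc M))) q)"
  define W where "W = (\<lambda>l. shift_op ((1 - X ^ (l - 1)) * cyc_poly (\<beta> - {#l#})) (rising_binom (Suc (Suc (Suc M)))) q)"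
  have "(\<Sum>x\<in>A. \<Sum>y\<in>A - {x}. \<Sum>c\<in>long_cycles (A - {x} - {y}). q ^ card (cycles_on A (c \<circ> transpose x y \<circ> p)))
      = (\<Sum>x\<in>A. fact M * (q * V (card (orbit p x)) + of_nat (Suc M) * W (card (orbit p x))))"
    unfolding V_def W_def \<beta>_def
    by (intro sum.cong refl two_cycle_long_sum p card ge card_orbit_mem_cycle_type_on)
  also have "\<dots> = fact M * (q * (\<Sum>x\<in>A. V (card (orbit p x))) + of_nat (Suc M) * (\<Sum>x\<in>A. W (card (orbit p x))))"
    by (simp only: sum_distrib_left sum.distrib distrib_left)
  also have "\<dots> = fact M * (q * (\<Sum>l\<in>#\<beta>. of_nat l * V l) + of_nat (Suc M) * (\<Sum>l\<in>#\<beta>. of_nat l * W l))"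
    unfolding \<beta>_def by (simp only: sum_mset_cycle_type_on[OF p])
  also have "q * (\<Sum>l\<in>#\<beta>. of_nat l * V l) + of_nat (Suc M) * (\<Sum>l\<in>#\<beta>. of_nat l * W l)
      = q * ((q + 1) * U (q + 2) + (q - 1) * U (q + 1))"
    unfolding V_def W_def U_def \<beta>_def
  proof (rule two_cycle_closed_form)
    show "2 \<le> l" if "l \<in># cycle_type_on A p" for l using ge[OF that] by simp
    show "sum_mset (cycle_type_on A p) = Suc (Suc (Suc M))" using sum_cycle_type_on[OF p] card by simp
  qed
  finally show ?thesis .
qed

section \<open>Summation over permutations of types [2, n - 2] and [1, n - 1]\<close>

definition cycle_class :: "'a set \<Rightarrow> nat multiset \<Rightarrow> ('a \<Rightarrow> 'a) set" where
  "cycle_class A \<alpha> = {\<sigma>. \<sigma> permutes A \<and> cycle_type_on A \<sigma> = \<alpha>}"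

lemma finite_cycle_class: "finite A \<Longrightarrow> finite (cycle_class A \<alpha>)"
  unfolding cycle_class_def by (rule finite_subset[OF _ finite_permutations[of A]]) auto

lemma card_points_with_orbit_size:
  assumes "\<sigma> \<in> cycle_class A \<alpha>" "finite A"
  shows "card {x \<in> A. card (orbit \<sigma> x) = k} = k * count \<alpha> k"
proof -
  have \<sigma>: "\<sigma> permutes A" "cycle_type_on A \<sigma> = \<alpha>" using assms(1) by (auto simp: cycle_class_def)
  have "card {x \<in> A. card (orbit \<sigma> x) = k} = (\<Sum>x\<in>A. if card (orbit \<sigma> x) = k then 1 else 0)"
    using assms(2) by (simp add: sum.If_cases Int_def)
  also have "\<dots> = (\<Sum>j\<in>#\<alpha>. of_nat j * (if j = k then 1 else 0))"
    using sum_mset_cycle_type_on[OF \<sigma>(1) assms(2), of "\<lambda>j. if j = k then 1 else 0 :: nat"] by (simp only: \<sigma>(2))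
  also have "\<dots> = k * count \<alpha> k"
    by (induction \<alpha>) auto
  finally show ?thesis .
qed

text \<open>Since \<open>c\<close> fixes \<open>x\<close> and \<open>y\<close>, the product is the
  disjoint union of a 2-cycle and a long cycle on the complement.\<close>

lemma comp_transpose_cycle_class:
  assumes fin: "finite A" and x: "x \<in> A" and y: "y \<in> A - {x}" and c: "c \<in> long_cycles (A - {x} - {y})"
  defines "\<sigma> \<equiv> c \<circ> transpose x y"
  shows "\<sigma> \<in> cycle_class A {#2, card A - 2#}" "card (orbit \<sigma> x) = 2" "\<sigma> x = y"
proof -
  note cp = long_cycles_permutes[OF c]
  have cfix: "c x = x" "c y = y" using cp by (auto simp: permutes_def)
  show sx: "\<sigma> x = y" by (simp add: \<sigma>_def cfix)
  have sy: "\<sigma> y = x" by (simp add: \<sigma>_def cfix)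
  have c': "c permutes A" using cp by (rule permutes_subset) auto
  have \<sigma>: "\<sigma> permutes A"
    unfolding \<sigma>_def using x y by (intro permutes_compose[OF permutes_swap_id c']) auto
  define b where "b = (\<lambda>i :: nat. if i = 0 then x else y)"
  have "orbit \<sigma> (b 0) = b ` {..<2}"
    by (rule orbit_cyclic_enum) (auto simp: b_def sx sy)
  hence ox: "orbit \<sigma> x = {x, y}" by (auto simp: b_def lessThan_Suc numeral_2_eq_2)
  thus c2: "card (orbit \<sigma> x) = 2" using y by auto
  have "orbit \<sigma> w = A - {x} - {y}" if w: "w \<in> A - {x} - {y}" for w
  proof -
    have "orbit \<sigma> w = orbit c w"
    proof (rule orbit_cong)
      show "w \<in> orbit c w" using orbit_long_cycles[OF c w] w by simp
      show "\<sigma> s = c s" if "s \<in> orbit c w" for s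
        using that orbit_long_cycles[OF c w] by (simp add: \<sigma>_def)
    qed
    thus ?thesis using orbit_long_cycles[OF c w] by simp
  qed
  moreover have "A - {x} - {y} \<noteq> {}"
  proof
    assume "A - {x} - {y} = {}"
    with c show False by (simp add: long_cycles_def cycles_on_def)
  qed
  ultimately have "cycles_on (A - {x} - {y}) \<sigma> = {A - {x} - {y}}"
    by (auto simp: cycles_on_def)
  hence "cycle_type_on (A - {x} - {y}) \<sigma> = {#card (A - {x} - {y})#}"
    by (simp add: cycle_type_on_def)
  also have "card (A - {x} - {y}) = card A - 2" using fin x y by simp
  finally have "cycle_type_on (A - orbit \<sigma> x) \<sigma> = {#card A - 2#}"
    unfolding ox by (simp add: Diff_insert2 [symmetric] insert_commute)
  moreover have "cycle_type_on A \<sigma> = add_mset (card (orbit \<sigma> x)) (cycle_type_on (A - orbit \<sigma> x) \<sigma>)"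
    using permutes_orbit_subset[OF \<sigma>] by (intro cycle_type_on_remove_orbit[OF \<sigma> fin _ x]) auto
  ultimately show "\<sigma> \<in> cycle_class A {#2, card A - 2#}"
    using \<sigma> by (simp add: cycle_class_def c2)
qed

text \<open>Removing the orbit of \<open>x\<close> leaves a single part, equal to the size of the
  complement, so any orbit inside the complement fills it.\<close>

lemma cycle_class_decompose:
  assumes fin: "finite A" and \<sigma>: "\<sigma> \<in> cycle_class A {#k, card A - k#}"
    and x: "x \<in> A" "card (orbit \<sigma> x) = k" and w: "w \<in> A - orbit \<sigma> x"
  shows "orbit \<sigma> w = A - orbit \<sigma> x"
proof -
  have p: "\<sigma> permutes A" and type: "cycle_type_on A \<sigma> = {#k, card A - k#}"
    using \<sigma> by (auto simp: cycle_class_def)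
  have sub: "orbit \<sigma> x \<subseteq> A" using permutes_orbit_subset[OF p x(1)] .
  have "cycle_type_on A \<sigma> = add_mset k (cycle_type_on (A - orbit \<sigma> x) \<sigma>)"
    using permutes_orbit_subset[OF p] x by (subst cycle_type_on_remove_orbit[OF p fin _ x(1)]) auto
  hence "cycle_type_on (A - orbit \<sigma> x) \<sigma> = {#card A - k#}" using type by simp
  moreover have "card (orbit \<sigma> w) \<in># cycle_type_on (A - orbit \<sigma> x) \<sigma>"
    using fin w by (intro card_orbit_mem_cycle_type_on) auto
  ultimately have "card (orbit \<sigma> w) = card A - k" by simp
  also have "\<dots> = card (A - orbit \<sigma> x)"
    using card_Diff_subset[OF finite_orbit_permutes[OF p fin] sub] x(2) by simp
  finally have "card (orbit \<sigma> w) = card (A - orbit \<sigma> x)" .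
  moreover have "orbit \<sigma> w \<subseteq> A - orbit \<sigma> x"
    using w permutes_orbit_subset[OF p, of w] orbit_disjoint[OF p fin, of w x] by blast
  ultimately show ?thesis using fin by (intro card_subset_eq) auto
qed

text \<open>The inverse of \<open>comp_transpose_cycle_class\<close>: a point \<open>x\<close> on a
  2-cycle determines \<open>y\<close> and the complementary long cycle.\<close>

lemma cycle_class_del_two:
  assumes fin: "finite A" and \<sigma>: "\<sigma> \<in> cycle_class A {#2, card A - 2#}" and card: "card A \<ge> 3"
    and x: "x \<in> A" "card (orbit \<sigma> x) = 2"
  shows "\<sigma> x \<in> A - {x}" "\<sigma> \<circ> transpose x (\<sigma> x) \<in> long_cycles (A - {x} - {\<sigma> x})"
proof -
  have p: "\<sigma> permutes A" using \<sigma> by (auto simp: cycle_class_def)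
  define y where "y = \<sigma> x"
  define c where "c = \<sigma> \<circ> transpose x y"
  have yx: "y \<noteq> x" using card_orbit_eq_1_iff[OF p fin, of x] x(2) by (auto simp: y_def)
  have yA: "y \<in> A" using p x(1) by (simp add: y_def permutes_in_image)
  show "\<sigma> x \<in> A - {x}" using yx yA by (simp add: y_def)
  have sub: "{x, y} \<subseteq> orbit \<sigma> x"
    using orbit_self[OF p fin, of x] orbit.base[of \<sigma> x] by (simp add: y_def)
  have ox: "orbit \<sigma> x = {x, y}"
    using card_subset_eq[OF finite_orbit_permutes[OF p fin] sub] x(2) yx by simp
  have "\<sigma> y \<in> {x, y}" using orbit.step[of y \<sigma> x] ox by simp
  hence sy: "\<sigma> y = x" using yx permutes_inj[OF p] by (auto simp: y_def inj_eq)
  have AA: "A - {x} - {y} = A - orbit \<sigma> x" unfolding ox by auto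
  have "c permutes A"
    unfolding c_def using x(1) yA by (intro permutes_compose[OF permutes_swap_id p]) auto
  hence "c permutes A - {x} - {y}"
    by (rule permutes_superset) (auto simp: c_def sy y_def [symmetric])
  moreover have "A - {x} - {y} \<noteq> {}"
  proof
    assume "A - {x} - {y} = {}"
    hence "A \<subseteq> {x, y}" by blast
    hence "card A \<le> 2" using card_mono[of "{x, y}" A] yx by simp
    with card show False by simp
  qed
  moreover have "orbit c w = A - {x} - {y}" if w: "w \<in> A - {x} - {y}" for w
  proof -
    have o: "orbit \<sigma> w = A - {x} - {y}"
      using cycle_class_decompose[OF fin \<sigma> x, of w] w unfolding AA by blast
    have "orbit c w = orbit \<sigma> w"
      by (rule orbit_cong[OF orbit_self[OF p fin]]) (auto simp: o c_def)
    thus ?thesis using o by simp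
  qed
  ultimately show "\<sigma> \<circ> transpose x (\<sigma> x) \<in> long_cycles (A - {x} - {\<sigma> x})"
    unfolding c_def y_def by (rule long_cyclesI)
qed

text \<open>Each \<open>\<sigma>\<close> is counted once per point of its 2-cycles; for \<open>card A = 4\<close> there are two of these.\<close>

lemma sum_cycle_class_two:
  fixes h :: "('a \<Rightarrow> 'a) \<Rightarrow> complex"
  assumes fin: "finite A" and card: "card A \<ge> 3"
  shows "(\<Sum>x\<in>A. \<Sum>y\<in>A - {x}. \<Sum>c\<in>long_cycles (A - {x} - {y}). h (c \<circ> transpose x y))
    = of_nat (2 * count {#2, card A - 2#} 2) * (\<Sum>\<sigma>\<in>cycle_class A {#2, card A - 2#}. h \<sigma>)"
proof -
  define S where "S = Sigma A (\<lambda>x. Sigma (A - {x}) (\<lambda>y. long_cycles (A - {x} - {y})))"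
  define T where "T = Sigma (cycle_class A {#2, card A - 2#}) (\<lambda>\<sigma>. {x \<in> A. card (orbit \<sigma> x) = 2})"
  have "(\<Sum>x\<in>A. \<Sum>y\<in>A - {x}. \<Sum>c\<in>long_cycles (A - {x} - {y}). h (c \<circ> transpose x y))
      = (\<Sum>(x, y, c)\<in>S. h (c \<circ> transpose x y))"
    unfolding S_def using fin by (simp add: sum.Sigma finite_long_cycles split_def)
  also have "\<dots> = (\<Sum>(\<sigma>, x)\<in>T. h \<sigma>)"
  proof (rule sum.reindex_bij_witness[where j = "\<lambda>(x, y, c). (c \<circ> transpose x y, x)"
        and i = "\<lambda>(\<sigma>, x). (x, \<sigma> x, \<sigma> \<circ> transpose x (\<sigma> x))"])
    fix s assume "s \<in> S"
    then obtain x y c where s: "s = (x, y, c)" and xyc: "x \<in> A" "y \<in> A - {x}" "c \<in> long_cycles (A - {x} - {y})"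
      by (auto simp: S_def)
    note cc = comp_transpose_cycle_class[OF fin xyc]
    show "(\<lambda>(x, y, c). (c \<circ> transpose x y, x)) s \<in> T" using cc xyc(1) by (simp add: T_def s)
    have "c \<circ> transpose x y \<circ> transpose x y = c"
      by (simp only: comp_assoc transpose_comp_involutory comp_id)
    thus "(\<lambda>(\<sigma>, x). (x, \<sigma> x, \<sigma> \<circ> transpose x (\<sigma> x))) ((\<lambda>(x, y, c). (c \<circ> transpose x y, x)) s) = s"
      unfolding s using cc(3) by (simp only: prod.case)
    show "(case (\<lambda>(x, y, c). (c \<circ> transpose x y, x)) s of (\<sigma>, x) \<Rightarrow> h \<sigma>) = (case s of (x, y, c) \<Rightarrow> h (c \<circ> transpose x y))"
      by (simp add: s)
  next
    fix t assume "t \<in> T"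
    then obtain \<sigma> x where t: "t = (\<sigma>, x)" and \<sigma>: "\<sigma> \<in> cycle_class A {#2, card A - 2#}"
      and x: "x \<in> A" "card (orbit \<sigma> x) = 2" by (auto simp: T_def)
    show "(\<lambda>(\<sigma>, x). (x, \<sigma> x, \<sigma> \<circ> transpose x (\<sigma> x))) t \<in> S"
      using cycle_class_del_two[OF fin \<sigma> card x] x(1) by (simp add: S_def t)
    have "\<sigma> \<circ> transpose x (\<sigma> x) \<circ> transpose x (\<sigma> x) = \<sigma>"
      by (simp only: comp_assoc transpose_comp_involutory comp_id)
    thus "(\<lambda>(x, y, c). (c \<circ> transpose x y, x)) ((\<lambda>(\<sigma>, x). (x, \<sigma> x, \<sigma> \<circ> transpose x (\<sigma> x))) t) = t"
      by (simp only: t prod.case)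
  qed
  also have "\<dots> = (\<Sum>\<sigma>\<in>cycle_class A {#2, card A - 2#}. \<Sum>x | x \<in> A \<and> card (orbit \<sigma> x) = 2. h \<sigma>)"
    unfolding T_def using fin by (subst sum.Sigma) (auto simp: finite_cycle_class)
  also have "\<dots> = (\<Sum>\<sigma>\<in>cycle_class A {#2, card A - 2#}. of_nat (2 * count {#2, card A - 2#} 2) * h \<sigma>)"
  proof (intro sum.cong refl)
    fix \<sigma> assume "\<sigma> \<in> cycle_class A {#2, card A - 2#}"
    from card_points_with_orbit_size[OF this fin, of 2]
    show "(\<Sum>x | x \<in> A \<and> card (orbit \<sigma> x) = 2. h \<sigma>) = of_nat (2 * count {#2, card A - 2#} 2) * h \<sigma>"
      by (simp only: sum_constant)
  qed
  finally show ?thesis by (simp only: sum_distrib_left)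
qed

lemma long_cycles_cycle_class:
  assumes fin: "finite A" and x: "x \<in> A" and c: "c \<in> long_cycles (A - {x})"
  shows "c \<in> cycle_class A {#1, card A - 1#}" "card (orbit c x) = 1"
proof -
  note cp = long_cycles_permutes[OF c]
  have c': "c permutes A" using cp by (rule permutes_subset) auto
  have ox: "orbit c x = {x}" using cp by (auto simp: orbit_eq_singleton_iff permutes_def)
  thus "card (orbit c x) = 1" by simp
  have "cycle_type_on (A - {x}) c = {#card A - 1#}"
    using c fin x by (simp add: long_cycles_def cycle_type_on_def)
  moreover have "cycle_type_on A c = add_mset (card (orbit c x)) (cycle_type_on (A - orbit c x) c)"
    using permutes_orbit_subset[OF c'] by (intro cycle_type_on_remove_orbit[OF c' fin _ x]) auto
  ultimately show "c \<in> cycle_class A {#1, card A - 1#}"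
    using c' by (simp add: cycle_class_def ox)
qed

lemma sum_cycle_class_one:
  fixes h :: "('a \<Rightarrow> 'a) \<Rightarrow> complex"
  assumes fin: "finite A" and card: "card A \<ge> 3"
  shows "(\<Sum>x\<in>A. \<Sum>c\<in>long_cycles (A - {x}). h c) = (\<Sum>\<sigma>\<in>cycle_class A {#1, card A - 1#}. h \<sigma>)"
proof -
  define T where "T = Sigma (cycle_class A {#1, card A - 1#}) (\<lambda>\<sigma>. {x \<in> A. card (orbit \<sigma> x) = 1})"
  have "(\<Sum>x\<in>A. \<Sum>c\<in>long_cycles (A - {x}). h c) = (\<Sum>(x, c)\<in>Sigma A (\<lambda>x. long_cycles (A - {x})). h c)"
    using fin by (simp add: sum.Sigma finite_long_cycles)
  also have "\<dots> = (\<Sum>(\<sigma>, x)\<in>T. h \<sigma>)"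
  proof (rule sum.reindex_bij_witness[where j = prod.swap and i = prod.swap])
    fix t assume "t \<in> T"
    then obtain \<sigma> x where t: "t = (\<sigma>, x)" and \<sigma>: "\<sigma> \<in> cycle_class A {#1, card A - 1#}"
      and x: "x \<in> A" "card (orbit \<sigma> x) = 1" by (auto simp: T_def)
    have p: "\<sigma> permutes A" using \<sigma> by (auto simp: cycle_class_def)
    have sx: "\<sigma> x = x" using card_orbit_eq_1_iff[OF p fin, of x] x(2) by simp
    hence ox: "orbit \<sigma> x = {x}" by (simp add: orbit_eq_singleton_iff)
    have "\<sigma> permutes A - {x}" using p by (rule permutes_superset) (auto simp: sx)
    moreover have "A - {x} \<noteq> {}"
    proof
      assume "A - {x} = {}"
      hence "card A \<le> 1" using card_mono[of "{x}" A] by auto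
      with card show False by simp
    qed
    moreover have "orbit \<sigma> w = A - {x}" if "w \<in> A - {x}" for w
      using cycle_class_decompose[OF fin \<sigma> x, of w] that by (simp add: ox)
    ultimately have "\<sigma> \<in> long_cycles (A - {x})" by (rule long_cyclesI)
    thus "prod.swap t \<in> Sigma A (\<lambda>x. long_cycles (A - {x}))" using x(1) by (simp add: t)
  qed (use long_cycles_cycle_class[OF fin] in \<open>auto simp: T_def\<close>)
  also have "\<dots> = (\<Sum>\<sigma>\<in>cycle_class A {#1, card A - 1#}. \<Sum>x | x \<in> A \<and> card (orbit \<sigma> x) = 1. h \<sigma>)"
    unfolding T_def using fin by (subst sum.Sigma) (auto simp: finite_cycle_class)
  also have "\<dots> = (\<Sum>\<sigma>\<in>cycle_class A {#1, card A - 1#}. h \<sigma>)"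
  proof (intro sum.cong refl)
    fix \<sigma> assume "\<sigma> \<in> cycle_class A {#1, card A - 1#}"
    from card_points_with_orbit_size[OF this fin, of 1]
    \<comment> \<open>As \<open>card A\<close> is at least 3, the part \<open>card A - 1\<close>
      differs from 1. The fixed point is unique and nothing is counted twice.\<close>
    have "card {x \<in> A. card (orbit \<sigma> x) = 1} = 1" using card by simp
    thus "(\<Sum>x | x \<in> A \<and> card (orbit \<sigma> x) = 1. h \<sigma>) = h \<sigma>" by simp
  qed
  finally show ?thesis .
qed

section \<open>Log-concavity from purely imaginary roots\<close>

text \<open>The inequality for all \<open>k\<close> excludes internal zeros, so after a strict
  descent the sequence never rises, and before a strict ascent it never fell. A descent before the
  index of a maximum, or an ascent after it, would contradict maximality.\<close>

lemma unimodal_of_log_concave: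
  fixes b :: "nat \<Rightarrow> nat"
  assumes lc: "\<And>i k. b i * b (i + k + 2) \<le> b (i + 1) * b (i + k + 1)"
    and supp: "\<And>i. i > N \<Longrightarrow> b i = 0"
  shows "unimodal b"
proof -
  have "finite (b ` {..N})" "b ` {..N} \<noteq> {}" by auto
  then obtain m where m: "b m = Max (b ` {..N})" using Max_in by (metis imageE)
  have max: "b i \<le> b m" for i
    using supp[of i] m by (cases "i \<le> N") auto
  have up: "b i \<le> b (Suc i)" if "i < m" for i
  proof (rule ccontr)
    assume "\<not> b i \<le> b (Suc i)"
    hence less: "b (Suc i) < b i" by simp
    have "b (i + k + 1) \<le> b (Suc i)" for k
    proof (induction k)
      case (Suc k)
      have "b i * b (i + k + 2) \<le> b (i + 1) * b (i + k + 1)" by (rule lc)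
      also have "\<dots> \<le> b i * b (i + k + 1)" using less by (intro mult_right_mono) auto
      finally have "b (i + k + 2) \<le> b (i + k + 1)" using less by simp
      thus ?case using Suc.IH by (simp add: eval_nat_numeral)
    qed simp
    from this[of "m - Suc i"] have "b m \<le> b (Suc i)" using that by simp
    thus False using less max[of i] by simp
  qed
  have down: "b (Suc i) \<le> b i" if "m \<le> i" for i
  proof (rule ccontr)
    assume "\<not> b (Suc i) \<le> b i"
    hence less: "b i < b (Suc i)" by simp
    have "k \<le> i \<Longrightarrow> b (i - k) \<le> b i" for k
    proof (induction k)
      case (Suc k)
      define j where "j = i - Suc k"
      have j: "i - k = j + 1" "i - Suc k = j" "i = j + k + 1" using Suc.prems by (auto simp: j_def)
      have "b j * b (j + k + 2) \<le> b (j + 1) * b (j + k + 1)" by (rule lc)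
      hence "b j * b (Suc i) \<le> b (j + 1) * b i" by (simp add: j(3))
      also have "\<dots> \<le> b (j + 1) * b (Suc i)" using less by (intro mult_left_mono) auto
      finally have "b j \<le> b (j + 1)" using less by simp
      moreover have "b (i - k) \<le> b i" using Suc.IH Suc.prems by simp
      ultimately show ?case unfolding j(1,2) by (rule order_trans)
    qed simp
    from this[of "i - m"] have "b m \<le> b i" using that by simp
    thus False using less max[of "Suc i"] by simp
  qed
  have "b r \<le> b s" if "r \<le> s" "s \<le> m" for r s
    using that
  proof (induction s rule: dec_induct)
    case (step s)
    thus ?case using up[of s] by simp
  qed simp
  hence "mono_on {..m} b" by (intro mono_onI) simp
  moreover have "b s \<le> b r" if "r \<le> s" "m \<le> r" for r s
    using that
  proof (induction s rule: dec_induct)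
    case (step s)
    thus ?case using down[of s] by simp
  qed simp
  hence "antimono_on {m..} b" by (intro monotone_onI) simp
  ultimately show ?thesis unfolding unimodal_def by blast
qed

text \<open>The condition with general \<open>k\<close> rules out internal zeros within a parity class, and unlike
  the case \<open>k = 0\<close> it is preserved under multiplication by \<open>x\<^sup>2 + b\<close>.\<close>

definition parity_log_concave :: "(nat \<Rightarrow> real) \<Rightarrow> bool" where
  "parity_log_concave a \<longleftrightarrow> (\<forall>i. 0 \<le> a i) \<and>
    (\<forall>i k. a i * a (i + 2 * k + 4) \<le> a (i + 2) * a (i + 2 * k + 2))"

lemma parity_log_concave_X_mult:
  assumes "parity_log_concave (coeff p)"
  shows "parity_log_concave (coeff ([:0, 1:] * p))"
proof -
  have X: "coeff ([:0, 1:] * p) (Suc n) = coeff p n" for n by simp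
  have "coeff ([:0, 1:] * p) i * coeff ([:0, 1:] * p) (i + 2 * k + 4)
      \<le> coeff ([:0, 1:] * p) (i + 2) * coeff ([:0, 1:] * p) (i + 2 * k + 2)" for i k
  proof (cases i)
    case 0
    thus ?thesis using assms by (simp add: parity_log_concave_def coeff_pCons split: nat.splits)
  next
    case (Suc s)
    have "coeff p s * coeff p (s + 2 * k + 4) \<le> coeff p (s + 2) * coeff p (s + 2 * k + 2)"
      using assms by (simp only: parity_log_concave_def)
    thus ?thesis by (simp only: Suc add_Suc X)
  qed
  moreover have "0 \<le> coeff ([:0, 1:] * p) i" for i
    using assms by (cases i) (auto simp: parity_log_concave_def)
  ultimately show ?thesis unfolding parity_log_concave_def by blast
qed

text \<open>New coefficients have the form \<open>b * a (i + 2) + a i\<close>. Both products are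
  expanded in powers of \<open>b\<close> and compared coefficient by coefficient; the first two
  indices lack the second summand and are treated apart.\<close>

lemma parity_log_concave_quadratic_mult:
  assumes p: "parity_log_concave (coeff p)" and b: "0 \<le> b"
  shows "parity_log_concave (coeff ([:b, 0, 1:] * p))"
proof -
  define a where "a = coeff p"
  define c where "c = coeff ([:b, 0, 1:] * p)"
  have nn: "0 \<le> a i" for i using p by (simp add: parity_log_concave_def a_def)
  have lc: "a i * a (i + 2 * k + 4) \<le> a (i + 2) * a (i + 2 * k + 2)" for i k
    using p by (simp add: parity_log_concave_def a_def)
  have c2: "c (i + 2) = b * a (i + 2) + a i" for i
    by (simp add: c_def a_def eval_nat_numeral)
  have c01: "c i = b * a i" if "i < 2" for i
    using that by (cases i) (auto simp: c_def a_def coeff_pCons split: nat.splits)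
  have "0 \<le> c i" for i
  proof (cases "i < 2")
    case False
    then obtain s where i: "i = s + 2" by (metis add.commute le_iff_add not_less)
    show ?thesis unfolding i c2 using nn b by (intro add_nonneg_nonneg mult_nonneg_nonneg)
  qed (use nn b c01 in auto)
  moreover have "c i * c (i + 2 * k + 4) \<le> c (i + 2) * c (i + 2 * k + 2)" for i k
  proof (cases "i < 2")
    case True
    have e1: "c (i + 2 * k + 4) = b * a (i + 2 * k + 4) + a (i + 2 * k + 2)"
      using c2[of "i + 2 * k + 2"] by (simp add: eval_nat_numeral)
    have e2: "c (i + 2 * k + 2) = b * a (i + 2 * k + 2) + a (i + 2 * k)"
      using c2[of "i + 2 * k"] by simp
    have "0 \<le> b * (a (i + 2) * a (i + 2 * k))" "0 \<le> a i * a (i + 2 * k)"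
      using nn b by auto
    moreover have "b\<^sup>2 * (a i * a (i + 2 * k + 4)) \<le> b\<^sup>2 * (a (i + 2) * a (i + 2 * k + 2))"
      using lc by (intro mult_left_mono) auto
    ultimately show ?thesis
      unfolding e1 e2 unfolding c01[OF True] c2 by (simp add: algebra_simps power2_eq_square)
  next
    case False
    then obtain s where i: "i = s + 2" by (metis add.commute le_iff_add not_less)
    have e1: "c (i + 2 * k + 4) = b * a (s + 2 * k + 6) + a (s + 2 * k + 4)"
      using c2[of "s + 2 * k + 4"] by (simp add: i eval_nat_numeral)
    have e2: "c (i + 2 * k + 2) = b * a (s + 2 * k + 4) + a (s + 2 * k + 2)"
      using c2[of "s + 2 * k + 2"] by (simp add: i eval_nat_numeral)
    have e3: "c (i + 2) = b * a (s + 4) + a (s + 2)"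
      using c2[of "s + 2"] by (simp add: i eval_nat_numeral)
    \<comment> \<open>This is the coefficient of \<open>b\<close> after cancelling the common
      product \<open>a (s + 2) * a (s + 2 * k + 4)\<close>. The indices are moved inwards twice, or
      once when \<open>k = 0\<close>, where the two middle indices merely trade places.\<close>
    have mid: "a s * a (s + 2 * k + 6) \<le> a (s + 4) * a (s + 2 * k + 2)"
    proof (cases k)
      case 0
      thus ?thesis using lc[of s 1] by (simp add: eval_nat_numeral mult.commute)
    next
      case (Suc k')
      have "a s * a (s + 2 * k + 6) \<le> a (s + 2) * a (s + 2 * k + 4)"
        using lc[of s "k + 1"] by (simp add: eval_nat_numeral)
      also have "\<dots> \<le> a (s + 4) * a (s + 2 * k + 2)"
        using lc[of "s + 2" k'] by (simp add: Suc eval_nat_numeral)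
      finally show ?thesis .
    qed
    have "b\<^sup>2 * (a (s + 2) * a (s + 2 * k + 6)) \<le> b\<^sup>2 * (a (s + 4) * a (s + 2 * k + 4))"
      using lc[of "s + 2" k] by (intro mult_left_mono) (auto simp: eval_nat_numeral)
    moreover have "b * (a s * a (s + 2 * k + 6)) \<le> b * (a (s + 4) * a (s + 2 * k + 2))"
      using mid b by (rule mult_left_mono)
    moreover note lc[of s k]
    ultimately show ?thesis
      unfolding e1 e2 e3 unfolding i c2 by (simp add: algebra_simps power2_eq_square)
  qed
  ultimately show ?thesis unfolding parity_log_concave_def c_def by blast
qed

abbreviation complex_poly :: "real poly \<Rightarrow> complex poly" where
  "complex_poly \<equiv> map_poly complex_of_real"

lemma complex_poly_mult: "complex_poly (p * q) = complex_poly p * complex_poly q"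
  by (rule poly_eqI) (simp add: coeff_map_poly coeff_mult)

text \<open>Induction on the degree, removing a real monic factor: \<open>x\<close> for the root 0,
  and \<open>x^2 + y^2\<close> for a nonzero root \<open>iy\<close>. Both factors preserve the
  property.\<close>

lemma parity_log_concave_of_imaginary_roots:
  fixes p :: "real poly"
  assumes "lead_coeff p > 0" "\<And>z. poly (complex_poly p) z = 0 \<Longrightarrow> Re z = 0"
  shows "parity_log_concave (coeff p)"
  using assms
proof (induction "degree p" arbitrary: p rule: less_induct)
  case less
  show ?case
  proof (cases "degree p = 0")
    case True
    then obtain c where "p = [:c:]" by (rule degree_eq_zeroE)
    thus ?thesis using less.prems(1)
      by (auto simp: parity_log_concave_def coeff_pCons split: nat.splits)
  next
    case False
    have "degree (complex_poly p) = degree p" by (rule degree_map_poly) auto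
    hence "\<not> constant (poly (complex_poly p))" using False by (simp add: constant_degree)
    then obtain z where z: "poly (complex_poly p) z = 0" using fundamental_theorem_of_algebra by blast
    have Re: "Re z = 0" using z less.prems(2) by blast
    obtain d s where ds: "p = d * s" and d: "lead_coeff d = 1" "degree d > 0"
      and step: "parity_log_concave (coeff s) \<Longrightarrow> parity_log_concave (coeff (d * s))"
    proof (cases "z = 0")
      case True
      have "coeff p 0 = 0"
        using z True by (simp add: poly_0_coeff_0 coeff_map_poly)
      then obtain s where "p = [:0, 1:] * s" by (cases p) auto
      thus ?thesis using that[of "[:0, 1:]" s] parity_log_concave_X_mult[of s] by simp
    next
      case False
      define y where "y = Im z"
      have y: "z = \<i> * of_real y" "y \<noteq> 0" using Re False by (auto simp: y_def complex_eq_iff)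
      define d where "d = [:y\<^sup>2, 0, 1:]"
      define r where "r = p mod d"
      have "degree r < 2" unfolding r_def using degree_mod_less'[of d p] by (cases "p mod d = 0") (auto simp: d_def)
      then obtain r0 r1 where r: "r = [:r0, r1:]"
        by (cases r rule: pCons_cases) (metis degree_eq_zeroE degree_pCons_eq_if less_2_cases_iff pCons_0_0 Suc_inject One_nat_def)
      have p: "p = d * (p div d) + r" by (simp add: r_def)
      have "complex_poly p = complex_poly d * complex_poly (p div d) + complex_poly r"
        by (subst p) (simp add: poly_eq_iff coeff_map_poly complex_poly_mult [symmetric])
      moreover have "poly (complex_poly d) z = 0"
        by (simp add: d_def map_poly_pCons y power2_eq_square algebra_simps)
      ultimately have "poly (complex_poly r) z = 0" using z by simp
      \<comment> \<open>The remainder satisfies \<open>r0 + r1 * i * y = 0\<close> with real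
        coefficients and \<open>y\<close> nonzero, so its real and imaginary parts vanish
        separately.\<close>
      hence "r0 = 0 \<and> r1 = 0" using y(2) by (simp add: r map_poly_pCons y(1) complex_eq_iff)
      hence "p = d * (p div d)" using p r by simp
      moreover have "parity_log_concave (coeff (d * (p div d)))" if "parity_log_concave (coeff (p div d))"
        unfolding d_def by (rule parity_log_concave_quadratic_mult) (use that in \<open>auto simp: d_def\<close>)
      ultimately show ?thesis using that[of d "p div d"] by (simp add: d_def)
    qed
    have s: "lead_coeff s > 0" using less.prems(1) d(1) by (simp add: ds lead_coeff_mult)
    have "degree s < degree p"
      using s d by (subst ds, subst degree_mult_eq) auto
    moreover have "Re w = 0" if "poly (complex_poly s) w = 0" for w
      using less.prems(2)[of w] that by (simp add: ds complex_poly_mult)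
    ultimately have "parity_log_concave (coeff s)" using s by (intro less.hyps) auto
    thus ?thesis unfolding ds by (rule step)
  qed
qed

lemma parity_sequences_of_imaginary_roots:
  fixes a :: "nat \<Rightarrow> nat"
  assumes F: "\<And>q. F q = (\<Sum>m\<le>n. of_nat (a m) * q ^ m)" and supp: "\<And>m. m > n \<Longrightarrow> a m = 0"
    and roots: "(\<forall>q. F q = 0) \<or> (\<forall>q. F q = 0 \<longrightarrow> Re q = 0)"
  shows "log_concave (\<lambda>i. a (2 * i + r)) \<and> unimodal (\<lambda>i. a (2 * i + r))"
proof -
  define p where "p = (\<Sum>m\<le>n. monom (real (a m)) m)"
  have coeff: "coeff p m = real (a m)" for m
    using supp[of m] by (cases "m \<le> n") (auto simp: p_def coeff_sum)
  have "complex_poly p = (\<Sum>m\<le>n. monom (of_nat (a m)) m)"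
    by (rule poly_eqI) (auto simp: coeff_map_poly coeff coeff_sum supp not_le)
  hence eval: "poly (complex_poly p) q = F q" for q
    by (simp add: poly_sum poly_monom F)
  have "parity_log_concave (coeff p)"
  proof (cases "p = 0")
    case True
    thus ?thesis by (simp add: parity_log_concave_def)
  next
    case False
    hence "complex_poly p \<noteq> 0" by (simp add: map_poly_eq_0_iff)
    hence "\<exists>q. F q \<noteq> 0" using poly_all_0_iff_0[of "complex_poly p"] eval by auto
    hence "Re q = 0" if "poly (complex_poly p) q = 0" for q
      using roots that eval by auto
    moreover have "lead_coeff p \<noteq> 0" using False by simp
    hence "lead_coeff p > 0" by (simp add: coeff)
    ultimately show ?thesis by (intro parity_log_concave_of_imaginary_roots)
  qed
  hence "real (a i * a (i + 2 * k + 4)) \<le> real (a (i + 2) * a (i + 2 * k + 2))" for i k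
    by (simp add: parity_log_concave_def coeff)
  hence lc: "a i * a (i + 2 * k + 4) \<le> a (i + 2) * a (i + 2 * k + 2)" for i k
    by (simp only: of_nat_le_iff)
  have lc': "a (2 * i + r) * a (2 * (i + k + 2) + r) \<le> a (2 * (i + 1) + r) * a (2 * (i + k + 1) + r)" for i k
  proof -
    have "2 * (i + k + 2) + r = 2 * i + r + 2 * k + 4" "2 * (i + 1) + r = 2 * i + r + 2"
      "2 * (i + k + 1) + r = 2 * i + r + 2 * k + 2" by simp_all
    thus ?thesis using lc[of "2 * i + r" k] by (simp only:)
  qed
  have "a (2 * (i - 1) + r) * a (2 * (i + 1) + r) \<le> (a (2 * i + r))\<^sup>2" if "i \<ge> 1" for i
    using lc'[of "i - 1" 0] that by (simp add: power2_eq_square)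
  moreover have "unimodal (\<lambda>i. a (2 * i + r))"
    by (rule unimodal_of_log_concave[where N = n]) (use lc' supp in auto)
  ultimately show ?thesis by (simp add: log_concave_def)
qed

section \<open>The generating function of the numbers \<open>\<xi>\<close>\<close>

text \<open>The map \<open>g\<close> carries the cycles of \<open>f \<circ> g\<close> bijectively to
  those of \<open>g \<circ> f\<close>.\<close>

lemma card_cycles_on_comp_commute:
  assumes f: "f permutes A" and g: "g permutes A" and fin: "finite A"
  shows "card (cycles_on A (f \<circ> g)) = card (cycles_on A (g \<circ> f))"
proof -
  have fg: "f \<circ> g permutes A" using permutes_compose[OF g f] .
  have "g ` orbit (f \<circ> g) a = orbit (g \<circ> f) (g a)" for a
    by (rule orbit_inverse[OF orbit_self[OF fg fin]]) simp
  hence "cycles_on A (g \<circ> f) = (`) g ` cycles_on A (f \<circ> g)"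
    unfolding cycles_on_def image_image by (simp add: permutes_image[OF g] flip: image_image[of "orbit (g \<circ> f)" g])
  moreover have "inj_on ((`) g) (cycles_on A (f \<circ> g))"
    by (rule inj_onI) (simp add: inj_image_eq_iff[OF permutes_inj[OF g]])
  ultimately show ?thesis by (simp add: card_image)
qed

lemma card_cycles_on_le: "finite A \<Longrightarrow> card (cycles_on A p) \<le> card A"
  unfolding cycles_on_def by (rule card_image_le)

lemma xi_eq:
  "xi n m \<alpha> \<beta> = card {s \<in> cycle_class {1..n} \<alpha> \<times> cycle_class {1..n} \<beta>.
     card (cycles_on {1..n} (fst s \<circ> snd s)) = m}"
  unfolding xi_def cycle_class_def by (rule arg_cong[of _ _ card]) auto

lemma xi_eq_0:
  assumes "m > n"
  shows "xi n m \<alpha> \<beta> = 0"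
proof -
  have "card (cycles_on {1..n} p) \<noteq> m" for p
    using card_cycles_on_le[of "{1..n}" p] assms by simp
  thus ?thesis by (simp add: xi_eq)
qed

lemma xi_generating_function:
  "(\<Sum>m\<le>n. of_nat (xi n m \<alpha> \<beta>) * q ^ m) =
   (\<Sum>\<sigma>\<in>cycle_class {1..n} \<alpha>. \<Sum>\<tau>\<in>cycle_class {1..n} \<beta>. q ^ card (cycles_on {1..n} (\<sigma> \<circ> \<tau>)) :: complex)"
proof -
  define S where "S = cycle_class {1..n} \<alpha> \<times> cycle_class {1..n} \<beta>"
  define k where "k = (\<lambda>s :: (nat \<Rightarrow> nat) \<times> (nat \<Rightarrow> nat). card (cycles_on {1..n} (fst s \<circ> snd s)))"
  have fin: "finite S" by (simp add: S_def finite_cycle_class)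
  have "(\<Sum>m\<le>n. of_nat (xi n m \<alpha> \<beta>) * q ^ m) = (\<Sum>m\<le>n. \<Sum>s | s \<in> S \<and> k s = m. q ^ k s)"
    by (intro sum.cong refl) (simp add: xi_eq S_def k_def)
  also have "\<dots> = (\<Sum>s\<in>S. q ^ k s)"
    using fin card_cycles_on_le[of "{1..n}"] by (intro sum.group) (auto simp: k_def)
  finally show ?thesis by (simp add: S_def k_def sum.cartesian_product split_def)
qed

section \<open>Location of the roots of the generating functions\<close>

lemma degree_one_minus_X_power:
  assumes "l > 0" shows "degree (1 - X ^ l) = l"
proof -
  have "degree (X ^ l) = l" by (simp add: degree_power_eq)
  thus ?thesis
    using assms degree_add_eq_right[of 1 "- (X ^ l)"] by (simp add: degree_minus)
qed

lemma cyc_poly_degree: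
  assumes "\<And>l. l \<in># \<gamma> \<Longrightarrow> l > 0"
  shows "cyc_poly \<gamma> \<noteq> 0" "degree (cyc_poly \<gamma>) = sum_mset \<gamma>"
proof -
  have "cyc_poly \<gamma> \<noteq> 0 \<and> degree (cyc_poly \<gamma>) = sum_mset \<gamma>"
    using assms
  proof (induction \<gamma>)
    case (add l \<gamma>)
    have l: "l > 0" using add.prems by simp
    have "1 - X ^ l \<noteq> 0" using degree_one_minus_X_power[OF l] l by (metis degree_0 less_irrefl)
    thus ?case using add degree_one_minus_X_power[OF l]
      by (simp only: cyc_poly_add_mset) (subst degree_mult_eq, auto)
  qed simp
  thus "cyc_poly \<gamma> \<noteq> 0" "degree (cyc_poly \<gamma>) = sum_mset \<gamma>" by auto
qed

lemma cyc_poly_roots: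
  assumes "\<And>l. l \<in># \<gamma> \<Longrightarrow> l > 0" "poly (cyc_poly \<gamma>) z = 0"
  shows "cmod z = 1"
  using assms
proof (induction \<gamma>)
  case (add l \<gamma>)
  show ?case
  proof (cases "poly (cyc_poly \<gamma>) z = 0")
    case True
    thus ?thesis using add by simp
  next
    case False
    hence "z ^ l = 1" using add.prems(2) by (simp add: cyc_poly_add_mset poly_power)
    hence "cmod z ^ l = 1" by (metis norm_one norm_power)
    thus ?thesis using add.prems(1)[of l] power_eq_1_iff[of "cmod z" l] by auto
  qed
qed simp

text \<open>The degree \<open>M + 3\<close> exceeds the index \<open>M + 1\<close>, so no linear
  factor is left and \<open>U\<close> is zero or has all roots on \<open>Re = 3 / 2\<close>. If
  \<open>Re q > 0\<close>, then \<open>q + 2\<close> is farther from this line than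
  \<open>q + 1\<close>, and \<open>q + 1\<close> has larger modulus than \<open>q - 1\<close>; the
  two summands cannot cancel. For \<open>Re q < 0\<close> both comparisons reverse.\<close>

lemma imaginary_roots_main_case:
  assumes "\<And>k. k \<in># \<beta> \<Longrightarrow> k > 0" "sum_mset \<beta> = Suc (Suc (Suc M))"
  defines "U \<equiv> shift_op (cyc_poly \<beta>) (rising_binom (Suc M))"
  shows "(\<forall>q. U q = 0) \<or> (\<forall>q. q * ((q + 1) * U (q + 2) + (q - 1) * U (q + 1)) = 0 \<longrightarrow> Re q = 0)"
proof -
  have ne: "cyc_poly \<beta> \<noteq> 0" by (rule cyc_poly_degree(1)[OF assms(1)])
  have unit: "cmod z = 1" if "poly (cyc_poly \<beta>) z = 0" for z
    by (rule cyc_poly_roots[OF assms(1) that])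
  have line: "(real (degree (cyc_poly \<beta>)) + 1 - real (Suc M)) / 2 = 3 / 2"
    "Suc M - degree (cyc_poly \<beta>) = 0"
    by (simp_all add: cyc_poly_degree(2)[OF assms(1)] assms(2))
  obtain p where p: "p = 0 \<or> roots_on_line (3 / 2) p" and U: "\<And>q. U q = poly p q"
    using shift_op_roots_on_line[OF ne unit, of "Suc M"] unfolding line U_def by auto
  show ?thesis
  proof (cases "p = 0")
    case False
    with p have line: "roots_on_line (3 / 2) p" by simp
    have "Re q = 0" if q: "q * ((q + 1) * U (q + 2) + (q - 1) * U (q + 1)) = 0" for q
    proof (rule ccontr)
      assume ne: "Re q \<noteq> 0"
      hence "(q + 1) * poly p (q + 2) = - ((q - 1) * poly p (q + 1))"
        using q by (auto simp: U add_eq_0_iff2)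
      hence eq: "cmod (q + 1) * cmod (poly p (q + 2)) = cmod (q - 1) * cmod (poly p (q + 1))"
        by (metis norm_minus_cancel norm_mult)
      show False
      proof (cases "Re q > 0")
        case True
        have "cmod (poly p (q + 1)) \<le> cmod (poly p (q + 2))"
          using True by (intro cmod_poly_le[OF line]) auto
        moreover have "cmod (q - 1) < cmod (q + 1)" using True by (intro cmod_less_of_Re) auto
        moreover have "poly p (q + 2) \<noteq> 0" using True line by (auto simp: roots_on_line_def)
        ultimately have "cmod (q - 1) * cmod (poly p (q + 1)) < cmod (q + 1) * cmod (poly p (q + 2))"
          by (intro order_le_less_trans[OF mult_left_mono mult_strict_right_mono]) auto
        thus False using eq by simp
      next
        case False
        with ne have neg: "Re q < 0" by simp
        have "cmod (poly p (q + 2)) \<le> cmod (poly p (q + 1))"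
          using neg by (intro cmod_poly_le[OF line]) auto
        moreover have "cmod (q + 1) < cmod (q - 1)" using neg by (intro cmod_less_of_Re) auto
        moreover have "poly p (q + 1) \<noteq> 0" using neg line by (auto simp: roots_on_line_def)
        ultimately have "cmod (q + 1) * cmod (poly p (q + 2)) < cmod (q - 1) * cmod (poly p (q + 1))"
          by (intro order_le_less_trans[OF mult_left_mono mult_strict_right_mono]) auto
        thus False using eq by simp
      qed
    qed
    thus ?thesis by blast
  qed (simp add: U)
qed

text \<open>The difference of the squared moduli is \<open>(u^2 - v^2) (1 - |z|^2)\<close>.\<close>

lemma cmod_affine_less:
  fixes u v :: real
  assumes "0 \<le> v" "v < u" "cmod z < 1"
  shows "cmod (of_real v + of_real u * z) < cmod (of_real u + of_real v * z)"
proof -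
  have "(cmod z)\<^sup>2 < 1" using assms(3) by (simp add: power_less_one_iff)
  moreover have "v\<^sup>2 < u\<^sup>2" using assms(1,2) by (intro power_strict_mono) auto
  ultimately have "0 < (u\<^sup>2 - v\<^sup>2) * (1 - (cmod z)\<^sup>2)" by simp
  also have "\<dots> = (cmod (of_real u + of_real v * z))\<^sup>2 - (cmod (of_real v + of_real u * z))\<^sup>2"
    by (simp only: cmod_power2) (simp add: algebra_simps power2_eq_square)
  finally show ?thesis by (simp add: power2_less_imp_less)
qed

lemma cmod_affine_greater:
  fixes u v :: real
  assumes "0 \<le> v" "v < u" "cmod z > 1"
  shows "cmod (of_real u + of_real v * z) < cmod (of_real v + of_real u * z)"
proof -
  have "(cmod z)\<^sup>2 > 1" using assms(3) by (simp add: one_less_power)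
  moreover have "v\<^sup>2 < u\<^sup>2" using assms(1,2) by (intro power_strict_mono) auto
  ultimately have "0 < (u\<^sup>2 - v\<^sup>2) * ((cmod z)\<^sup>2 - 1)" by simp
  also have "\<dots> = (cmod (of_real v + of_real u * z))\<^sup>2 - (cmod (of_real u + of_real v * z))\<^sup>2"
    by (simp only: cmod_power2) (simp add: algebra_simps power2_eq_square)
  finally show ?thesis by (simp add: power2_less_imp_less)
qed

text \<open>A root satisfies \<open>u + v z = z^M (v + u z)\<close> with \<open>v < u\<close>.
  Inside the unit disc the left side has strictly larger modulus, outside it strictly
  smaller.\<close>

lemma roots_on_unit_circle_one_case:
  fixes M :: nat
  assumes M: "M \<ge> 1"
  defines "b \<equiv> [:of_nat (M + 3), of_nat (M + 1):] - X ^ M * [:of_nat (M + 1), of_nat (M + 3):]"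
  shows "b \<noteq> 0" "degree b = Suc M" "poly b z = 0 \<Longrightarrow> cmod z = 1"
proof -
  have X: "X ^ M = monom 1 M" by (simp add: monom_altdef)
  have coeff: "coeff b (Suc M) \<noteq> 0"
  proof -
    have "coeff b (Suc M) = - of_nat (M + 3)"
      using M by (auto simp: b_def X coeff_monom_mult coeff_pCons split: nat.splits)
    thus ?thesis by (simp only: neg_equal_0_iff_equal of_nat_eq_0_iff)
  qed
  thus "b \<noteq> 0" by auto
  have "coeff b i = 0" if "i > Suc M" for i
  proof -
    have "2 \<le> i" "2 \<le> i - M" using that by auto
    then obtain j k where "i = Suc (Suc j)" "i - M = Suc (Suc k)"
      by (metis Suc_le_D Suc_le_mono numeral_2_eq_2)
    thus ?thesis using that by (simp add: b_def X coeff_monom_mult)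
  qed
  hence "degree b \<le> Suc M" by (intro degree_le) auto
  thus "degree b = Suc M" using le_degree[OF coeff] by simp
  show "cmod z = 1" if z: "poly b z = 0"
  proof (rule ccontr)
    define u v where "u = real (M + 3)" and "v = real (M + 1)"
    have uv: "0 \<le> v" "v < u" by (simp_all add: u_def v_def)
    have "of_real u + of_real v * z = z ^ M * (of_real v + of_real u * z)"
      using z by (simp add: b_def u_def v_def poly_power algebra_simps)
    hence eq: "cmod (of_real u + of_real v * z) = cmod z ^ M * cmod (of_real v + of_real u * z)"
      by (metis norm_mult norm_power)
    assume "cmod z \<noteq> 1"
    then consider "cmod z < 1" | "cmod z > 1" by linarith
    thus False
    proof cases
      case 1
      hence "cmod z ^ M * cmod (of_real v + of_real u * z) \<le> 1 * cmod (of_real v + of_real u * z)"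
        by (intro mult_right_mono power_le_one) auto
      thus False using cmod_affine_less[OF uv 1] eq by simp
    next
      case 2
      hence "1 * cmod (of_real v + of_real u * z) \<le> cmod z ^ M * cmod (of_real v + of_real u * z)"
        by (intro mult_right_mono one_le_power) auto
      thus False using cmod_affine_greater[OF uv 2] eq by simp
    qed
  qed
qed

text \<open>For \<open>M > 0\<close> the two polynomials combine to \<open>(1 - X) * b\<close>, and
  \<open>b\<close> has degree \<open>M + 1\<close> against index \<open>M + 2\<close>: one factor
  \<open>q\<close> remains and the other roots lie on \<open>Re = 0\<close>. For
  \<open>M = 0\<close> the long cycle degenerates to a fixed point, and direct evaluation gives
  \<open>q (q^2 + 2)\<close>.\<close>

lemma imaginary_roots_one_case:
  fixes M :: nat
  defines "V \<equiv> \<lambda>q. 2 * shift_op (cyc_poly {#1, Suc M#}) (rising_binom (M + 3)) q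
    + of_nat (Suc M) * ((if M = 0 then q else 1) * shift_op (cyc_poly (part M + {#2#})) (rising_binom (M + 3)) q)"
  shows "(\<forall>q. V q = 0) \<or> (\<forall>q. V q = 0 \<longrightarrow> Re q = 0)"
proof (cases "M = 0")
  case True
  have "cyc_poly {#1, Suc M#} = (1 - X) * ((1 - X) * 1)"
    by (simp only: True cyc_poly_add_mset cyc_poly_empty One_nat_def [symmetric] power_one_right)
  moreover have "cyc_poly (part M + {#2#}) = (1 - X) * (1 + X)"
  proof -
    have "part M + {#2#} = {#2#}" by (simp add: True part_def)
    moreover have "1 - x\<^sup>2 = (1 - x) * (1 + x)" for x :: "complex poly"
      by (simp add: power2_eq_square algebra_simps)
    ultimately show ?thesis by (simp only: cyc_poly_add_mset cyc_poly_empty mult_1_right)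
  qed
  ultimately have "V q = 2 * shift_op 1 (rising_binom (Suc 0)) q + q * shift_op (1 + X) (rising_binom (Suc (Suc 0))) q" for q
    by (simp only: V_def True add_0 eval_nat_numeral shift_op_one_minus_X) simp
  also have "\<dots> q = q * (q\<^sup>2 + 2)" for q
    by (simp add: shift_op_pCons one_pCons rising_binom_def pochhammer_Suc power2_eq_square field_simps)
  finally have V: "V q = q * (q\<^sup>2 + 2)" for q .
  have "Re q = 0" if "V q = 0" for q
  proof (cases "q = 0")
    case False
    hence "q\<^sup>2 = - 2" using that by (simp add: V add_eq_0_iff2)
    hence "Re (q\<^sup>2) = - 2" "Im (q\<^sup>2) = 0" by simp_all
    hence "(Re q)\<^sup>2 - (Im q)\<^sup>2 = - 2" "Re q * Im q = 0" by (simp_all add: Re_power2 Im_power2)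
    hence "Re q = 0 \<or> (Re q)\<^sup>2 = - 2" by auto
    moreover have "(Re q)\<^sup>2 \<noteq> - 2" using zero_le_power2[of "Re q"] by linarith
    ultimately show ?thesis by blast
  qed simp
  thus ?thesis by blast
next
  case False
  hence M: "M \<ge> 1" by simp
  define b where "b = [:of_nat (M + 3), of_nat (M + 1):] - X ^ M * [:of_nat (M + 1), of_nat (M + 3):]"
  note circle = roots_on_unit_circle_one_case[OF M, folded b_def]
  have eq: "of_nat 2 * cyc_poly {#1, Suc M#} + of_nat (Suc M) * cyc_poly (part M + {#2#}) = (1 - X) * b"
  proof -
    define x where "x = X"
    have lin: "[:of_nat i, of_nat j:] = of_nat i + of_nat j * x" for i j
      by (simp add: x_def of_nat_poly)
    have b: "b = (of_nat (M + 3) + of_nat (M + 1) * x) - x ^ M * (of_nat (M + 1) + of_nat (M + 3) * x)"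
      unfolding b_def lin x_def ..
    have c: "cyc_poly {#1, Suc M#} = (1 - x) * (1 - x * x ^ M)"
      "cyc_poly (part M + {#2#}) = (1 - x ^ M) * (1 - x * x)"
      using False unfolding cyc_poly_part
      by (simp_all only: cyc_poly_add_mset cyc_poly_empty x_def power2_eq_square power_Suc power_one_right
          mult_1_right if_False)
    show ?thesis unfolding x_def [symmetric] b c by (simp add: algebra_simps)
  qed
  have "V q = shift_op ((1 - X) * b) (rising_binom (Suc (M + 2))) q" for q
    unfolding eq [symmetric] shift_op_add shift_op_of_nat_mult using False by (simp add: V_def numeral_3_eq_3)
  hence V: "V q = shift_op b (rising_binom (M + 2)) q" for q by (simp only: shift_op_one_minus_X)
  have line: "(real (degree b) + 1 - real (M + 2)) / 2 = 0" "M + 2 - degree b = Suc 0"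
    by (simp_all add: circle(2))
  obtain p where p: "p = 0 \<or> roots_on_line 0 p" "\<And>q. V q = pochhammer q (Suc 0) * poly p q"
    using shift_op_roots_on_line[OF circle(1,3), where N = "M + 2"] unfolding line V by auto
  thus ?thesis by (auto simp: roots_on_line_def)
qed

text \<open>The fixed point \<open>x\<close> of the varying permutation is deleted from
  \<open>p\<close>. Two choices of \<open>x\<close> shorten the 2-cycle; the other
  \<open>M + 1\<close> shorten the long part, which for \<open>M = 0\<close> is a fixed point and
  gives the factor \<open>q\<close>.\<close>

lemma one_cycle_total_sum:
  assumes fin: "finite A" and card: "card A = M + 3" and p: "p \<in> cycle_class A {#2, Suc M#}"
  shows "(\<Sum>x\<in>A. \<Sum>c\<in>long_cycles (A - {x}). q ^ card (cycles_on A (c \<circ> p)))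
    = fact (Suc M) * (2 * shift_op (cyc_poly {#1, Suc M#}) (rising_binom (M + 3)) q
    + of_nat (Suc M) * ((if M = 0 then q else 1) * shift_op (cyc_poly (part M + {#2#})) (rising_binom (M + 3)) q))"
proof -
  have perm: "p permutes A" and type: "cycle_type_on A p = {#2, Suc M#}"
    using p by (auto simp: cycle_class_def)
  define F where "F = (\<lambda>l. (if l = 1 then q else 1) *
    (fact (Suc M) * shift_op (cyc_poly (part (l - 1) + ({#2, Suc M#} - {#l#}))) (rising_binom (M + 3)) q))"
  have "(\<Sum>c\<in>long_cycles (A - {x}). q ^ card (cycles_on A (c \<circ> p))) = F (card (orbit p x))" if x: "x \<in> A" for x
  proof -
    have "(\<Sum>c\<in>long_cycles (A - {x}). q ^ card (cycles_on A (c \<circ> p)))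
        = (if p x = x then q else 1) * long_sum (A - {x}) (del x p) q"
      unfolding long_sum_def sum_distrib_left
      by (intro sum.cong refl power_card_cycles_on_del[OF perm fin x] long_cycles_permutes)
    also have "long_sum (A - {x}) (del x p) q = fact (Suc M) *
        shift_op (cyc_poly (cycle_type_on (A - {x}) (del x p))) (rising_binom (Suc (Suc (Suc M)))) q"
      using fin card x by (intro long_sum_eq del_permutes[OF perm x]) auto
    also have "Suc (Suc (Suc M)) = M + 3" by simp
    finally show ?thesis
      unfolding F_def cycle_type_on_del[OF perm fin x] type card_orbit_eq_1_iff[OF perm fin] .
  qed
  hence "(\<Sum>x\<in>A. \<Sum>c\<in>long_cycles (A - {x}). q ^ card (cycles_on A (c \<circ> p))) = (\<Sum>x\<in>A. F (card (orbit p x)))"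
    by (intro sum.cong refl)
  also have "\<dots> = of_nat 2 * F 2 + of_nat (Suc M) * F (Suc M)"
    unfolding sum_mset_cycle_type_on[OF perm fin] type by simp
  also have "F 2 = fact (Suc M) * shift_op (cyc_poly {#1, Suc M#}) (rising_binom (M + 3)) q"
    by (simp add: F_def part_def add_mset_commute[of "Suc 0" "Suc M"])
  also have "F (Suc M) = fact (Suc M) * ((if M = 0 then q else 1) * shift_op (cyc_poly (part M + {#2#})) (rising_binom (M + 3)) q)"
    by (simp add: F_def add_mset_commute[of 2 "Suc M"] del: fact_Suc)
  finally show ?thesis by (simp only: distrib_left mult.left_commute of_nat_numeral)
qed

lemma xi_imaginary_roots:
  assumes "n \<ge> 3" "is_partition \<beta> n" "(\<forall>b\<in>#\<beta>. b \<ge> 3) \<or> \<beta> = {#1, n - 1#}"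
  defines "F \<equiv> \<lambda>q :: complex. \<Sum>m\<le>n. of_nat (xi n m {#2, n - 2#} \<beta>) * q ^ m"
  shows "(\<forall>q. F q = 0) \<or> (\<forall>q. F q = 0 \<longrightarrow> Re q = 0)"
proof -
  obtain M where n: "n = M + 3" using assms(1) by (metis add.commute le_iff_add)
  define A where "A = {1..n}"
  have fin: "finite A" and card: "card A = n" by (simp_all add: A_def)
  have F: "F q = (\<Sum>\<sigma>\<in>cycle_class A {#2, n - 2#}. \<Sum>\<tau>\<in>cycle_class A \<beta>. q ^ card (cycles_on A (\<sigma> \<circ> \<tau>)))" for q
    unfolding F_def A_def by (rule xi_generating_function)
  from assms(3) show ?thesis
  proof
    assume ge: "\<forall>b\<in>#\<beta>. b \<ge> 3"
    define U where "U = shift_op (cyc_poly \<beta>) (rising_binom (Suc M))"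
    define G where "G = (\<lambda>q. q * ((q + 1) * U (q + 2) + (q - 1) * U (q + 1)))"
    \<comment> \<open>This is the multiplicity with which \<open>sum_cycle_class_two\<close> counts
      each permutation.\<close>
    define \<kappa> where "\<kappa> = (of_nat (2 * count {#2, n - 2#} 2) :: complex)"
    define N where "N = (of_nat (card (cycle_class A \<beta>)) :: complex)"
    have sum: "sum_mset \<beta> = Suc (Suc (Suc M))" using assms(2) by (simp add: is_partition_def n)
    have \<kappa>: "\<kappa> \<noteq> 0" unfolding \<kappa>_def by (simp only: of_nat_eq_0_iff) simp
    have "\<kappa> * (\<Sum>\<sigma>\<in>cycle_class A {#2, n - 2#}. q ^ card (cycles_on A (\<sigma> \<circ> \<tau>))) = fact M * G q"
      if \<tau>: "\<tau> \<in> cycle_class A \<beta>" for \<tau> q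
    proof -
      have t: "\<tau> permutes A" "cycle_type_on A \<tau> = \<beta>" using \<tau> by (auto simp: cycle_class_def)
      have "\<kappa> * (\<Sum>\<sigma>\<in>cycle_class A {#2, n - 2#}. q ^ card (cycles_on A (\<sigma> \<circ> \<tau>)))
        = (\<Sum>x\<in>A. \<Sum>y\<in>A - {x}. \<Sum>c\<in>long_cycles (A - {x} - {y}). q ^ card (cycles_on A (c \<circ> transpose x y \<circ> \<tau>)))"
        unfolding \<kappa>_def card [symmetric]
        by (rule sum_cycle_class_two [symmetric]) (use fin card assms(1) in auto)
      also have "\<dots> = fact M * G q"
        unfolding G_def U_def t(2) [symmetric]
        by (rule two_cycle_total_sum) (use t fin card n ge in auto)
      finally show ?thesis .
    qed
    \<comment> \<open>The inner sum depends on \<open>\<tau>\<close> only through its cycle type, so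
      the sum over \<open>\<tau>\<close> just multiplies by the class size.\<close>
    hence "\<kappa> * F q = N * (fact M * G q)" for q
      unfolding F by (subst sum.swap) (simp add: sum_distrib_left N_def)
    hence "F q = 0 \<longleftrightarrow> N = 0 \<or> G q = 0" for q
      using \<kappa> by (metis fact_nonzero mult_eq_0_iff)
    moreover have "(\<forall>q. U q = 0) \<or> (\<forall>q. G q = 0 \<longrightarrow> Re q = 0)"
      unfolding G_def U_def using ge sum by (intro imaginary_roots_main_case) auto
    ultimately show ?thesis by (auto simp: G_def)
  next
    assume \<beta>: "\<beta> = {#1, n - 1#}"
    define V where "V = (\<lambda>q. 2 * shift_op (cyc_poly {#1, Suc M#}) (rising_binom (M + 3)) q
      + of_nat (Suc M) * ((if M = 0 then q else 1) * shift_op (cyc_poly (part M + {#2#})) (rising_binom (M + 3)) q))"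
    define N where "N = (of_nat (card (cycle_class A {#2, n - 2#})) :: complex)"
    have "(\<Sum>\<tau>\<in>cycle_class A \<beta>. q ^ card (cycles_on A (\<sigma> \<circ> \<tau>))) = fact (Suc M) * V q"
      if \<sigma>: "\<sigma> \<in> cycle_class A {#2, n - 2#}" for \<sigma> q
    proof -
      \<comment> \<open>The roles are exchanged here: \<open>\<sigma>\<close> is held fixed, and the
        varying factor \<open>\<tau>\<close> is commuted to the left, where the long-cycle formulas
        apply.\<close>
      have "(\<Sum>\<tau>\<in>cycle_class A \<beta>. q ^ card (cycles_on A (\<sigma> \<circ> \<tau>)))
          = (\<Sum>\<tau>\<in>cycle_class A \<beta>. q ^ card (cycles_on A (\<tau> \<circ> \<sigma>)))"
        using \<sigma> fin card_cycles_on_comp_commute[of \<sigma> A] by (intro sum.cong refl) (auto simp: cycle_class_def)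
      also have "\<dots> = (\<Sum>x\<in>A. \<Sum>c\<in>long_cycles (A - {x}). q ^ card (cycles_on A (c \<circ> \<sigma>)))"
        unfolding \<beta> card [symmetric] by (rule sum_cycle_class_one [symmetric]) (use fin card assms(1) in auto)
      also have "\<dots> = fact (Suc M) * V q"
        unfolding V_def by (rule one_cycle_total_sum) (use fin card n \<sigma> in auto)
      finally show ?thesis .
    qed
    hence "F q = N * (fact (Suc M) * V q)" for q
      unfolding F by (simp add: N_def del: fact_Suc)
    moreover have "(\<forall>q. V q = 0) \<or> (\<forall>q. V q = 0 \<longrightarrow> Re q = 0)"
      unfolding V_def by (rule imaginary_roots_one_case)
    ultimately show ?thesis
      by (cases "N = 0") (auto simp del: fact_Suc)
  qed
qed

theorem corollary4p4:
  fixes n :: nat and \<beta> :: "nat multiset"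
  assumes "n \<ge> 3"
    and "is_partition \<beta> n"
    and "(\<forall>b\<in>#\<beta>. b \<ge> 3) \<or> \<beta> = {#1, n - 1#}"
  shows "log_concave (\<lambda>i. xi n (2 * i + 1) {#2, n - 2#} \<beta>) \<and>
         unimodal (\<lambda>i. xi n (2 * i + 1) {#2, n - 2#} \<beta>) \<and>
         log_concave (\<lambda>i. xi n (2 * i + 2) {#2, n - 2#} \<beta>) \<and>
         unimodal (\<lambda>i. xi n (2 * i + 2) {#2, n - 2#} \<beta>)"
  using parity_sequences_of_imaginary_roots[OF refl xi_eq_0 xi_imaginary_roots[OF assms], of 1]
    parity_sequences_of_imaginary_roots[OF refl xi_eq_0 xi_imaginary_roots[OF assms], of 2]
  by simp

end
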